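(* Let $h=h_2\circ h_1^\star$ be a mixed tabulation hash function with $d$ derived characters, and let $\varepsilon>0$ be a constant. For any input set $X\subseteq[u]$ with $|X|\le |\Sigma|/(1+\varepsilon)$, with probability $1-O(|\Sigma|^{1-\lfloor d/2\rfloor})$ the keys of $X$ hash independently, i.e. the hash values $h(x)$, $x\in X$, are mutually independent and uniformly distributed over $\mathcal R$.
   Context: Simple tabulation: fix an integer $c\ge1$ and an alphabet $\Sigma$ whose size is a power of two (characters are bit strings). A key $x\in[u]$ is viewed as a vector $(x_0,\dots,x_{c-1})$ of $c$ characters in $\Sigma$ (each character is a block of about $\lg u^{1/c}$ bits of $x$). A simple tabulation function $g:\Sigma^c\to\mathcal R$, where $\mathcal R=[2^r]$ is a set of bit strings (or $\mathcal R=\Sigma^d$), is given by $c$ independent fully random tables $T_i:\Sigma\to\mathcal R$ and $g(x)=T_0[x_0]\oplus\cdots\oplus T_{c-1}[x_{c-1}]$, where $\oplus$ is bitwise XOR. Mixed tabulation with parameters $c,d$: take independent simple tabulation functions $h_1:\Sigma^c\to\Sigma^d$ and $h_2:\Sigma^{c+d}\to\mathcal R$; the derived key is $h_1^\star(x)=x\cdot h_1(x)\in\Sigma^{c+d}$ ($\cdot$ = concatenation of characters) and $h(x)=h_2(h_1^\star(x))$. Standing assumptions: $c=O(1)$, $d=O(1)$, $u^{1/c}\le|\Sigma|\le u^{1/(c-1)}$; constants in $O(\cdot)$ may depend on $c$, $d$ and $\varepsilon$. *)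

theory Defs
  imports "HOL-Probability.Probability" "HOL-Probability.Product_PMF"
begin

text \<open>A bit string of length \<open>n\<close> is identified with the natural number below \<open>2 ^ n\<close> that it
  represents in binary; bitwise exclusive or is then \<open>xor\<close> on natural numbers. The alphabet is
  \<open>bit_strings s\<close> and the hash range is \<open>bit_strings r\<close>.\<close>

definition bit_strings :: "nat \<Rightarrow> nat set" where
  "bit_strings n = {..<2 ^ n}"

definition char_vectors :: "nat \<Rightarrow> nat \<Rightarrow> nat list set" where
  "char_vectors s n = {v. length v = n \<and> set v \<subseteq> bit_strings s}"

definition vec_xor :: "nat list \<Rightarrow> nat list \<Rightarrow> nat list" where
  "vec_xor = map2 xor"

text \<open>The bits of a key are cut into \<open>c\<close> consecutive blocks; block \<open>i\<close> has \<open>w i\<close> bits.\<close>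

definition key_chars :: "nat \<Rightarrow> (nat \<Rightarrow> nat) \<Rightarrow> nat \<Rightarrow> nat list" where
  "key_chars c w x = map (\<lambda>i. take_bit (w i) (drop_bit (\<Sum>j<i. w j) x)) [0..<c]"

text \<open>The tables are stored as one function: \<open>T (i, a)\<close> is entry \<open>a\<close> of table \<open>i\<close>. All entries
  are independent and uniform in \<open>R\<close>.\<close>

definition random_tables :: "nat \<Rightarrow> nat \<Rightarrow> 'r set \<Rightarrow> (nat \<times> nat \<Rightarrow> 'r) pmf" where
  "random_tables n s R =
     Pi_pmf ({..<n} \<times> bit_strings s) undefined (\<lambda>_. pmf_of_set R)"

text \<open>Simple tabulation is parameterised by the exclusive or of the range and its neutral
  element, so that it can be used with range \<open>bit_strings r\<close> as well as \<open>char_vectors s d\<close>.\<close>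

definition simple_tab ::
  "('r \<Rightarrow> 'r \<Rightarrow> 'r) \<Rightarrow> 'r \<Rightarrow> (nat \<times> nat \<Rightarrow> 'r) \<Rightarrow> nat list \<Rightarrow> 'r" where
  "simple_tab f z T v = foldr f (map (\<lambda>i. T (i, v ! i)) [0..<length v]) z"

definition derived_key :: "nat \<Rightarrow> (nat \<times> nat \<Rightarrow> nat list) \<Rightarrow> nat list \<Rightarrow> nat list" where
  "derived_key d T1 v = v @ simple_tab vec_xor (replicate d 0) T1 v"

definition mixed_tab ::
  "nat \<Rightarrow> (nat \<times> nat \<Rightarrow> nat list) \<Rightarrow> (nat \<times> nat \<Rightarrow> nat) \<Rightarrow> nat list \<Rightarrow> nat" where
  "mixed_tab d T1 T2 v = simple_tab xor 0 T2 (derived_key d T1 v)"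

text \<open>For fixed tables \<open>T1\<close> of the first function, the only randomness left is in the tables of
  the second one: the hash values of the keys in \<open>X\<close> are required to be independent and uniform
  over the choice of the latter. Tables outside the support of the distribution may have values
  outside \<open>bit_strings r\<close>, so the hash values are random variables in \<open>count_space UNIV\<close>;
  the second conjunct says that they are uniform on \<open>bit_strings r\<close>.\<close>

definition hash_independently ::
  "nat \<Rightarrow> nat \<Rightarrow> nat \<Rightarrow> nat \<Rightarrow> (nat \<Rightarrow> nat) \<Rightarrow> nat set \<Rightarrow> (nat \<times> nat \<Rightarrow> nat list) \<Rightarrow> bool" where
  "hash_independently c d s r w X T1 \<longleftrightarrow>
     prob_space.indep_vars (measure_pmf (random_tables (c + d) s (bit_strings r)))
       (\<lambda>_. count_space UNIV)
       (\<lambda>x T2. mixed_tab d T1 T2 (key_chars c w x)) X \<and>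
     (\<forall>x\<in>X. map_pmf (\<lambda>T2. mixed_tab d T1 T2 (key_chars c w x))
                (random_tables (c + d) s (bit_strings r))
              = pmf_of_set (bit_strings r))"

end

theory Submission
  imports Defs "HOL-Library.Z2"
begin

text \<open>A set of keys hashes independently if its derived keys can be peeled, i.e. unless it has a core:
  a nonempty set \<open>Y\<close> of keys in which every derived character of every key also occurs for another
  key of \<open>Y\<close>. Group the derived characters into \<open>d div 2\<close> pairs. From any key of a core one can, for
  each pair, walk forever inside the core along keys that agree alternatingly in the first and in the
  second character of the pair. Either the first \<open>O(log m)\<close> steps, \<open>m\<close> being the size of the
  alphabet, are independent events, or some step is implied by the steps before it.

  \<open>k\<close> independent steps have probability \<open>m\<^sup>-\<^sup>k\<close>. An implied step forces some \<open>2 t \<ge> 4\<close> keys of the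
  walk to cancel modulo 2 in every input character, and only \<open>O(n\<^sup>t)\<close> of all \<open>n\<^sup>2\<^sup>t\<close> tuples of \<open>n\<close> keys
  do so. As \<open>n / m\<close> is bounded away from 1, the expected number of such walks from all of the \<open>n\<close> keys
  is therefore \<open>O(n / m)\<close>, so some key starts only \<open>O(1 / m)\<close> of them on average. For this key the
  \<open>d div 2\<close> pairs are independent, hence it belongs to a core with probability \<open>O(1 / m ^ (d div 2))\<close>.
  Remove it and repeat; the union bound over the at most \<open>m\<close> keys gives the claim. (The detour over the
  average is needed: single keys may start far more than \<open>O(1 / m)\<close> walks.)\<close>

section \<open>Linear algebra modulo 2\<close>

unbundle bit_operations_syntax

declare add_bit_eq_xor [simp del] mult_bit_eq_and [simp del]

lemma bit_add_eq_1_iff: "x + y = (1::bit) \<longleftrightarrow> x \<noteq> y"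
  by (cases x; cases y) auto

lemma bit_add_eq_0_iff: "x + y = (0::bit) \<longleftrightarrow> x = y"
  by (cases x; cases y) auto

text \<open>The Fredholm alternative over the field with two elements: a vector outside the span of
  the \<open>D i\<close> is detected by a linear functional \<open>W\<close> that kills them all.
  The proof adds one spanning vector at a time.\<close>

lemma F2_span_or_separated:
  fixes D :: "'i \<Rightarrow> 'a \<Rightarrow> bit"
  assumes "finite A" "finite I"
  shows "(\<exists>J\<subseteq>I. \<forall>a\<in>A. E a = (\<Sum>i\<in>J. D i a)) \<or>
         (\<exists>W. (\<forall>i\<in>I. (\<Sum>a\<in>A. W a * D i a) = 0) \<and> (\<Sum>a\<in>A. W a * E a) = 1)"
proof -
  define ip where "ip W F = (\<Sum>a\<in>A. W a * F a)" for W F :: "'a \<Rightarrow> bit"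
  have ip_add_left: "ip (\<lambda>a. V a + W a) F = ip V F + ip W F" for V W F
    by (simp only: ip_def distrib_right sum.distrib)
  have ip_add_right: "ip W (\<lambda>a. F a + G a) = ip W F + ip W G" for W F G
    by (simp only: ip_def distrib_left sum.distrib)
  have ip_point: "ip (\<lambda>b. of_bool (b = a)) F = F a" if "a \<in> A" for a F
  proof -
    have "ip (\<lambda>b. of_bool (b = a)) F = (\<Sum>b\<in>A. if b = a then F b else 0)"
      unfolding ip_def by (rule sum.cong) auto
    then show ?thesis using that assms(1) by simp
  qed
  let ?span = "\<lambda>I E. \<exists>J\<subseteq>I. \<forall>a\<in>A. E a = (\<Sum>i\<in>J. D i a)"
  let ?sep = "\<lambda>I E W. (\<forall>i\<in>I. ip W (D i) = 0) \<and> ip W E = 1"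
  have "?span I E \<or> (\<exists>W. ?sep I E W)"
    using assms(2)
  proof (induction I arbitrary: E rule: finite_induct)
    case empty
    show ?case
      using ip_point[of _ E] by (cases "\<forall>a\<in>A. E a = 0") (simp, metis bit_not_zero_iff empty_iff)
  next
    case (insert k I)
    show ?case
    proof (cases "?span I E")
      case True
      then show ?thesis by blast
    next
      case False
      with insert.IH[of E] obtain W where W: "?sep I E W" by blast
      show ?thesis
      proof (cases "ip W (D k) = 0")
        case True
        with W show ?thesis by blast
      next
        case Wk: False
        \<comment> \<open>\<open>W\<close> separates \<open>E\<close> from the old vectors but does
          not kill \<open>D k\<close>. If \<open>E + D k\<close> lies in the old span,
          \<open>E\<close> lies in the new one; otherwise the functional for \<open>E + D k\<close>
          either serves for \<open>E\<close> itself or does so after adding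
          \<open>W\<close>.\<close>
        let ?E = "\<lambda>a. E a + D k a"
        show ?thesis
        proof (cases "?span I ?E")
          case True
          then obtain J where J: "J \<subseteq> I" "\<forall>a\<in>A. ?E a = (\<Sum>i\<in>J. D i a)" by blast
          have fin: "finite J" "k \<notin> J"
            using J(1) insert.hyps finite_subset by auto
          have "E a = (\<Sum>i\<in>insert k J. D i a)" if "a \<in> A" for a
          proof -
            have "E a = D k a + (E a + D k a)" by (cases "E a"; cases "D k a") simp_all
            also have "\<dots> = D k a + (\<Sum>i\<in>J. D i a)" using J(2) that by simp
            finally show ?thesis using fin by simp
          qed
          moreover have "insert k J \<subseteq> insert k I" using J(1) by blast
          ultimately show ?thesis by blast
        next
          case False
          with insert.IH[of ?E] obtain W' where W': "?sep I ?E W'" by blast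
          have E': "ip W' E + ip W' (D k) = 1"
            using W' ip_add_right by metis
          show ?thesis
          proof (cases "ip W' (D k) = 0")
            case True
            with W' E' have "?sep (insert k I) E W'" by simp
            then show ?thesis by blast
          next
            case False
            have "ip W' E = 0" using False E' by (cases "ip W' E") simp_all
            moreover have "\<forall>i\<in>I. ip W (D i) + ip W' (D i) = 0" using W W' by simp
            moreover have "ip W (D k) + ip W' (D k) = 0" using Wk False by simp
            ultimately have "?sep (insert k I) E (\<lambda>a. W a + W' a)"
              unfolding ip_add_left using W by simp
            then show ?thesis by blast
          qed
        qed
      qed
    qed
  qed
  then show ?thesis by (simp only: ip_def)
qed

section \<open>Tables and systems of equations\<close>

text \<open>The incidence vector of the table entries that \<open>v\<close> reads; implications
  between equations on hash values become linear dependence of such vectors modulo 2.\<close>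

definition char_ind :: "nat list \<Rightarrow> nat \<times> nat \<Rightarrow> bit" where
  "char_ind v = (\<lambda>(i, a). of_bool (v ! i = a))"

text \<open>The functional \<open>W\<close> applied to \<open>char_ind v\<close>, that is, the
  parity of the number of entries selected by \<open>W\<close> among those that \<open>v\<close>
  reads.\<close>

definition entry_sum :: "(nat \<times> nat \<Rightarrow> bit) \<Rightarrow> nat list \<Rightarrow> bit" where
  "entry_sum W v = (\<Sum>i<length v. W (i, v ! i))"

lemma finite_bit_strings [simp]: "finite (bit_strings n)"
  by (simp add: bit_strings_def)

lemma card_bit_strings [simp]: "card (bit_strings n) = 2 ^ n"
  by (simp add: bit_strings_def)

lemma zero_in_bit_strings [simp]: "0 \<in> bit_strings n"
  by (simp add: bit_strings_def)

lemma bit_strings_nonempty [simp]: "bit_strings n \<noteq> {}"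
  using zero_in_bit_strings by blast

lemma xor_in_bit_strings:
  "a \<in> bit_strings n \<Longrightarrow> b \<in> bit_strings n \<Longrightarrow> a XOR b \<in> bit_strings n"
  by (metis bit_strings_def lessThan_iff take_bit_nat_eq_self_iff take_bit_xor)

lemma finite_char_vectors [simp]: "finite (char_vectors s n)"
proof -
  have "char_vectors s n = {v. set v \<subseteq> bit_strings s \<and> length v = n}"
    by (auto simp: char_vectors_def)
  then show ?thesis using finite_lists_length_eq[OF finite_bit_strings] by simp
qed

lemma replicate_in_char_vectors: "replicate n 0 \<in> char_vectors s n"
  by (auto simp: char_vectors_def)

lemma char_vectors_nonempty [simp]: "char_vectors s n \<noteq> {}"
  using replicate_in_char_vectors by blast

lemma sum_char_ind_eq_entry_sum:
  assumes "v \<in> char_vectors s c"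
  shows "(\<Sum>e\<in>{..<c} \<times> bit_strings s. W e * char_ind v e) = entry_sum W v"
proof -
  have "(\<Sum>e\<in>{..<c} \<times> bit_strings s. W e * char_ind v e) =
      (\<Sum>i<c. \<Sum>a\<in>bit_strings s. W (i, a) * of_bool (v ! i = a))"
    unfolding sum.cartesian_product by (intro sum.cong) (auto simp: char_ind_def)
  also have "\<dots> = (\<Sum>i<c. \<Sum>a\<in>bit_strings s. if a = v ! i then W (i, a) else 0)"
    by (intro sum.cong) auto
  also have "\<dots> = (\<Sum>i<c. W (i, v ! i))"
  proof (intro sum.cong refl)
    fix i assume "i \<in> {..<c}"
    then have "v ! i \<in> bit_strings s"
      using assms by (auto simp: char_vectors_def)
    then show "(\<Sum>a\<in>bit_strings s. if a = v ! i then W (i, a) else 0) = W (i, v ! i)"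
      by simp
  qed
  finally show ?thesis
    using assms by (simp add: entry_sum_def char_vectors_def)
qed

text \<open>Two shifts by \<open>a\<close> cancel, so only the parity of the number of shifted
  entries matters.\<close>

lemma foldr_xor_shift:
  fixes g :: "'a \<Rightarrow> nat"
  shows "foldr xor (map (\<lambda>i. g i XOR (if P i = (1::bit) then a else 0)) is) 0 =
    foldr xor (map g is) 0 XOR (if sum_list (map P is) = 1 then a else 0)"
proof (induction "is")
  case (Cons i "is")
  then show ?case
    by (cases "P i"; cases "sum_list (map P is)") (auto simp: ac_simps simp flip: xor.assoc)
qed simp

lemma simple_tab_xor_shift:
  "simple_tab xor 0 (\<lambda>e. G e XOR (if W e = 1 then a else 0)) v =
     simple_tab xor (0::nat) G v XOR (if entry_sum W v = 1 then a else 0)"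
  unfolding simple_tab_def entry_sum_def foldr_xor_shift
  by (simp add: interv_sum_list_conv_sum_set_nat atLeast0LessThan)

lemma simple_tab_xor_in_bit_strings:
  assumes "\<And>i. i < length v \<Longrightarrow> G (i, v ! i) \<in> bit_strings r"
  shows "simple_tab xor (0::nat) G v \<in> bit_strings r"
proof -
  have *: "foldr xor ys 0 \<in> bit_strings r" if "set ys \<subseteq> bit_strings r" for ys
    using that by (induction ys) (auto simp: xor_in_bit_strings)
  show ?thesis
    unfolding simple_tab_def by (rule *) (use assms in auto)
qed

lemma simple_tab_cong:
  "(\<And>i. i < length v \<Longrightarrow> T (i, v ! i) = T' (i, v ! i)) \<Longrightarrow> simple_tab f z T v = simple_tab f z T' v"
  unfolding simple_tab_def by (intro arg_cong[of _ _ "\<lambda>l. foldr f l z"] map_cong) auto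

text \<open>\<open>vec_xor\<close> truncates to the shorter list, hence the condition on lengths.
  Under it the tabulation acts coordinatewise, and every derived character is itself a simple
  tabulation into \<open>nat\<close>.\<close>

lemma simple_tab_vec_xor:
  assumes "\<And>i. i < length v \<Longrightarrow> length (T (i, v ! i)) = d"
  shows length_simple_tab_vec_xor: "length (simple_tab vec_xor (replicate d 0) T v) = d"
    and nth_simple_tab_vec_xor: "j < d \<Longrightarrow>
      simple_tab vec_xor (replicate d 0) T v ! j = simple_tab xor 0 (\<lambda>e. T e ! j) v"
proof -
  have *: "length (foldr vec_xor ys (replicate d 0)) = d \<and>
      (\<forall>j<d. foldr vec_xor ys (replicate d 0) ! j = foldr xor (map (\<lambda>y. y ! j) ys) 0)"
    if "\<forall>y\<in>set ys. length y = d" for ys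
    using that by (induction ys) (auto simp: vec_xor_def)
  have "\<forall>y\<in>set (map (\<lambda>i. T (i, v ! i)) [0..<length v]). length y = d"
    using assms by auto
  from *[OF this] show "length (simple_tab vec_xor (replicate d 0) T v) = d"
    and "j < d \<Longrightarrow> simple_tab vec_xor (replicate d 0) T v ! j = simple_tab xor 0 (\<lambda>e. T e ! j) v"
    by (auto simp: simple_tab_def comp_def)
qed

section \<open>Derived characters and shifts of the tables\<close>

definition derived_char :: "(nat \<times> nat \<Rightarrow> nat list) \<Rightarrow> nat \<Rightarrow> nat list \<Rightarrow> nat" where
  "derived_char T j v = simple_tab xor 0 (\<lambda>e. T e ! j) v"

text \<open>The support of \<open>random_tables\<close>. The fixed value off the index set keeps it
  finite for finite \<open>R\<close>, so that probabilities become ratios of cardinalities.\<close>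

definition tables :: "nat \<Rightarrow> nat \<Rightarrow> 'r set \<Rightarrow> (nat \<times> nat \<Rightarrow> 'r) set" where
  "tables n s R = PiE_dflt ({..<n} \<times> bit_strings s) undefined (\<lambda>_. R)"

lemma tablesD: "T \<in> tables n s R \<Longrightarrow> i < n \<Longrightarrow> a \<in> bit_strings s \<Longrightarrow> T (i, a) \<in> R"
  by (auto simp: tables_def PiE_dflt_def)

lemma finite_tables [simp]: "finite R \<Longrightarrow> finite (tables n s R)"
  by (auto simp: tables_def intro!: finite_PiE_dflt)

lemma tables_nonempty: "R \<noteq> {} \<Longrightarrow> tables n s R \<noteq> {}"
  by (simp add: tables_def)

lemma random_tables_eq_pmf_of_set:
  "finite R \<Longrightarrow> R \<noteq> {} \<Longrightarrow> random_tables n s R = pmf_of_set (tables n s R)"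
  unfolding random_tables_def tables_def by (subst Pi_pmf_of_set) auto

lemma char_vectors_entry: "v \<in> char_vectors s c \<Longrightarrow> i < length v \<Longrightarrow> i < c \<and> v ! i \<in> bit_strings s"
  by (auto simp: char_vectors_def)

lemma derived_char_in_bit_strings:
  assumes "T \<in> tables c s (char_vectors s d)" "v \<in> char_vectors s c" "j < d"
  shows "derived_char T j v \<in> bit_strings s"
  unfolding derived_char_def
proof (rule simple_tab_xor_in_bit_strings)
  fix i assume "i < length v"
  then have "T (i, v ! i) \<in> char_vectors s d"
    using assms char_vectors_entry tablesD by blast
  then show "T (i, v ! i) ! j \<in> bit_strings s"
    using assms(3) by (auto simp: char_vectors_def)
qed

text \<open>Entries off the index set stay as they are; thus for \<open>a\<close> in the alphabet
  and \<open>j < d\<close> the shift is an involution of the sample space.\<close>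

definition shift_tables ::
    "nat \<Rightarrow> nat \<Rightarrow> (nat \<times> nat \<Rightarrow> bit) \<Rightarrow> nat \<Rightarrow> nat \<Rightarrow> (nat \<times> nat \<Rightarrow> nat list) \<Rightarrow> nat \<times> nat \<Rightarrow> nat list" where
  "shift_tables c s W j a T e =
     (if e \<in> {..<c} \<times> bit_strings s \<and> W e = 1 then (T e)[j := T e ! j XOR a] else T e)"

lemma shift_tables_in_tables:
  assumes "T \<in> tables c s (char_vectors s d)" "a \<in> bit_strings s" "j < d"
  shows "shift_tables c s W j a T \<in> tables c s (char_vectors s d)"
proof -
  have "v[j := v ! j XOR a] \<in> char_vectors s d" if "v \<in> char_vectors s d" for v
  proof -
    have "v ! j XOR a \<in> bit_strings s"
      using that assms(2,3) by (auto simp: char_vectors_def intro!: xor_in_bit_strings)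
    then show ?thesis
      using that set_update_subset_insert[of v j "v ! j XOR a"] by (auto simp: char_vectors_def)
  qed
  then show ?thesis
    using assms(1) by (auto simp: tables_def PiE_dflt_def shift_tables_def)
qed

lemma shift_tables_twice:
  assumes "T \<in> tables c s (char_vectors s d)" "j < d"
  shows "shift_tables c s W j a (shift_tables c s W j a T) = T"
proof
  fix e
  have "e \<in> {..<c} \<times> bit_strings s \<Longrightarrow> length (T e) = d"
    using assms(1) by (auto simp: tables_def PiE_dflt_def char_vectors_def)
  then show "shift_tables c s W j a (shift_tables c s W j a T) e = T e"
    using assms(2) by (auto simp: shift_tables_def xor.assoc)
qed

lemma derived_char_shift_tables:
  assumes "T \<in> tables c s (char_vectors s d)" "v \<in> char_vectors s c" "j < d"
  shows "derived_char (shift_tables c s W j a T) j' v =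
    derived_char T j' v XOR (if j = j' \<and> entry_sum W v = 1 then a else 0)"
proof -
  have len: "length (T (i, v ! i)) = d" "(i, v ! i) \<in> {..<c} \<times> bit_strings s" if "i < length v" for i
    using tablesD[OF assms(1)] char_vectors_entry[OF assms(2) that] by (auto simp: char_vectors_def)
  show ?thesis
  proof (cases "j = j'")
    case True
    have "derived_char (shift_tables c s W j a T) j' v =
        simple_tab xor 0 (\<lambda>e. T e ! j XOR (if W e = 1 then a else 0)) v"
      unfolding derived_char_def using len assms(3) True
      by (intro simple_tab_cong) (auto simp: shift_tables_def)
    then show ?thesis
      using True by (simp add: simple_tab_xor_shift derived_char_def)
  next
    case False
    then have "derived_char (shift_tables c s W j a T) j' v = derived_char T j' v"
      unfolding derived_char_def using len
      by (intro simple_tab_cong) (auto simp: shift_tables_def)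
    then show ?thesis using False by simp
  qed
qed

text \<open>An equation \<open>(j, x, y)\<close> asks that the keys \<open>x\<close> and \<open>y\<close> agree in derived character \<open>j\<close>.\<close>

definition eqs_hold :: "(nat \<times> nat \<Rightarrow> nat list) \<Rightarrow> (nat \<times> nat list \<times> nat list) set \<Rightarrow> bool" where
  "eqs_hold T E \<longleftrightarrow> (\<forall>(j, x, y)\<in>E. derived_char T j x = derived_char T j y)"

text \<open>The head is the newest equation. Only older equations for the same derived character can
  constrain it, since different derived characters read different coordinates of the tables;
  \<open>W\<close> is a functional that vanishes on those older equations but not on the new
  one.\<close>

fun indep_eqs :: "(nat \<times> nat list \<times> nat list) list \<Rightarrow> bool" where
  "indep_eqs [] \<longleftrightarrow> True"
| "indep_eqs ((j, x, y) # es) \<longleftrightarrow> indep_eqs es \<and>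
     (\<exists>W. entry_sum W x \<noteq> entry_sum W y \<and>
       (\<forall>(j', x', y')\<in>set es. j' = j \<longrightarrow> entry_sum W x' = entry_sum W y'))"

lemma indep_eqs_append:
  "indep_eqs es \<Longrightarrow> indep_eqs es' \<Longrightarrow> fst ` set es \<inter> fst ` set es' = {} \<Longrightarrow> indep_eqs (es @ es')"
proof (induction es)
  case (Cons e es)
  obtain j x y where e: "e = (j, x, y)" by (cases e)
  from Cons.prems e obtain W where "entry_sum W x \<noteq> entry_sum W y"
    "\<forall>(j', x', y')\<in>set es. j' = j \<longrightarrow> entry_sum W x' = entry_sum W y'" by auto
  moreover have "\<forall>(j', x', y')\<in>set es'. j' \<noteq> j"
    using Cons.prems(3) e by force
  ultimately have "\<exists>W. entry_sum W x \<noteq> entry_sum W y \<and>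
      (\<forall>(j', x', y')\<in>set (es @ es'). j' = j \<longrightarrow> entry_sum W x' = entry_sum W y')"
    by (intro exI[of _ W]) auto
  then show ?case using Cons e by auto
qed simp

lemma indep_eqs_concat:
  assumes "\<And>k. k < K \<Longrightarrow> indep_eqs (F k)"
    and "\<And>k l. k < K \<Longrightarrow> l < K \<Longrightarrow> k \<noteq> l \<Longrightarrow> fst ` set (F k) \<inter> fst ` set (F l) = {}"
  shows "indep_eqs (concat (map F [0..<K]))"
  using assms
proof (induction K)
  case (Suc K)
  have "fst ` set (concat (map F [0..<K])) \<inter> fst ` set (F K) = {}"
  proof -
    have "fst ` set (F k) \<inter> fst ` set (F K) = {}" if "k < K" for k
      using Suc.prems(2)[of k K] that by simp
    then have "(\<Union>k<K. fst ` set (F k)) \<inter> fst ` set (F K) = {}"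
      by blast
    moreover have "fst ` set (concat (map F [0..<K])) = (\<Union>k<K. fst ` set (F k))"
      by (simp add: image_UN atLeast0LessThan)
    ultimately show ?thesis by simp
  qed
  then show ?case using Suc by (simp add: indep_eqs_append)
qed simp

text \<open>Shifting the tables along a vector that separates the newest equation from the older ones
  turns one solution of all the equations into \<open>2 ^ s\<close> solutions of the older ones.\<close>

lemma card_indep_eqs_le:
  assumes "indep_eqs es"
    and "\<forall>(j, x, y)\<in>set es. j < d \<and> x \<in> char_vectors s c \<and> y \<in> char_vectors s c"
  shows "card {T \<in> tables c s (char_vectors s d). eqs_hold T (set es)} * 2 ^ (s * length es)
    \<le> card (tables c s (char_vectors s d))"
  using assms
proof (induction es)
  case (Cons e es)
  let ?\<Omega> = "tables c s (char_vectors s d)"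
  let ?A = "\<lambda>es. {T \<in> ?\<Omega>. eqs_hold T (set es)}"
  obtain j x y where e: "e = (j, x, y)" by (cases e)
  from Cons.prems(1) e obtain W where W: "entry_sum W x \<noteq> entry_sum W y"
    "\<forall>(j', x', y')\<in>set es. j' = j \<longrightarrow> entry_sum W x' = entry_sum W y'" by auto
  have jxy: "j < d" "x \<in> char_vectors s c" "y \<in> char_vectors s c"
    and es: "\<forall>(j', x', y')\<in>set es. j' < d \<and> x' \<in> char_vectors s c \<and> y' \<in> char_vectors s c"
    using Cons.prems(2) e by auto
  define sh where "sh = (\<lambda>(T, a). shift_tables c s W j a T)"
  \<comment> \<open>The shift moves exactly one of the two sides of the new equation, so the amount
    \<open>a\<close> can be read off the shifted tables. This makes \<open>sh\<close>
    injective.\<close>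
  have diff: "derived_char (sh (T, a)) j x XOR derived_char (sh (T, a)) j y = a"
    if "T \<in> ?A (e # es)" for T a
  proof -
    have "T \<in> ?\<Omega>" "derived_char T j x = derived_char T j y"
      using that e by (auto simp: eqs_hold_def)
    then show ?thesis
      using derived_char_shift_tables[of T c s d _ j W a j] jxy W(1)
      by (cases "entry_sum W x"; cases "entry_sum W y")
        (auto simp: sh_def ac_simps simp flip: xor.assoc)
  qed
  have "inj_on sh (?A (e # es) \<times> bit_strings s)"
  proof (rule inj_onI, clarify)
    fix T a T' a'
    assume *: "sh (T, a) = sh (T', a')" "T \<in> ?\<Omega>" "eqs_hold T (set (e # es))"
      "T' \<in> ?\<Omega>" "eqs_hold T' (set (e # es))"
    then have "a = a'" using diff[of T a] diff[of T' a'] by simp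
    moreover have "sh (sh (T, a), a) = T" "sh (sh (T', a'), a') = T'"
      using shift_tables_twice[OF *(2) jxy(1)] shift_tables_twice[OF *(4) jxy(1)]
      by (simp_all add: sh_def)
    ultimately show "T = T' \<and> a = a'" using * by metis
  qed
  \<comment> \<open>The older equations survive the shift: for each of them both sides move by the
    same amount.\<close>
  moreover have "sh ` (?A (e # es) \<times> bit_strings s) \<subseteq> ?A es"
  proof clarify
    fix T a assume *: "T \<in> ?\<Omega>" "eqs_hold T (set (e # es))" "a \<in> bit_strings s"
    have "derived_char (sh (T, a)) j' x' = derived_char (sh (T, a)) j' y'"
      if "(j', x', y') \<in> set es" for j' x' y'
    proof -
      have "derived_char T j' x' = derived_char T j' y'"
        using * that by (auto simp: eqs_hold_def)
      moreover have "x' \<in> char_vectors s c" "y' \<in> char_vectors s c"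
        "j' = j \<Longrightarrow> entry_sum W x' = entry_sum W y'"
        using es W(2) that by auto
      ultimately show ?thesis
        using derived_char_shift_tables[OF *(1) _ jxy(1)] by (auto simp: sh_def)
    qed
    then show "sh (T, a) \<in> ?\<Omega> \<and> eqs_hold (sh (T, a)) (set es)"
      using shift_tables_in_tables[OF *(1,3) jxy(1)] by (auto simp: sh_def eqs_hold_def)
  qed
  ultimately have "card (?A (e # es) \<times> bit_strings s) \<le> card (?A es)"
    by (intro card_inj_on_le[where f = sh]) auto
  then have "card (?A (e # es)) * 2 ^ s \<le> card (?A es)"
    by (simp add: card_cartesian_product)
  then have "card (?A (e # es)) * 2 ^ s * 2 ^ (s * length es) \<le> card (?A es) * 2 ^ (s * length es)"
    by (rule mult_le_mono1)
  also have "\<dots> \<le> card ?\<Omega>"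
    using Cons.IH Cons.prems(1) es e by simp
  finally show ?case
    by (simp add: power_add mult.assoc)
qed (simp add: eqs_hold_def)

section \<open>Tuples of keys that cancel\<close>

lemma sum_UN_le:
  fixes f :: "'a \<Rightarrow> real"
  assumes "finite I" "\<And>i. i \<in> I \<Longrightarrow> finite (B i)" "\<And>x. f x \<ge> 0"
  shows "sum f (\<Union>i\<in>I. B i) \<le> (\<Sum>i\<in>I. sum f (B i))"
  using assms(1,2)
proof (induction I rule: finite_induct)
  case (insert i I)
  have "sum f (B i \<union> (\<Union>i\<in>I. B i)) \<le> sum f (B i) + sum f (\<Union>i\<in>I. B i)"
    using insert.prems insert.hyps assms(3)
    by (subst sum_Un) (auto intro!: sum_nonneg)
  then show ?case using insert by fastforce
qed simp

text \<open>In a cancelling tuple every value occurs an even number of times, so a fixed index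
  \<open>k\<close> shares its value with some partner \<open>j\<close>. By Cauchy-Schwarz the pair
  contributes at most the product of the two Euclidean norms, and the remaining indices cancel
  again. Keeping \<open>N\<close> fixed instead of using \<open>card S\<close> makes the bound a
  product over \<open>S\<close> that passes through the induction.\<close>

lemma sum_prod_zero_tuples_one_char_le:
  fixes F :: "'i \<Rightarrow> 'a \<Rightarrow> real"
  assumes "finite A" "finite S" "\<And>i a. F i a \<ge> 0" "real (card S) \<le> N"
  shows "(\<Sum>b\<in>{b \<in> S \<rightarrow>\<^sub>E A. \<forall>a. (\<Sum>i\<in>S. of_bool (b i = a)) = (0::bit)}. \<Prod>i\<in>S. F i (b i))
    \<le> (\<Prod>i\<in>S. sqrt (N * (\<Sum>a\<in>A. (F i a)\<^sup>2)))"
  using assms(2,4)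
proof (induction S rule: finite_psubset_induct)
  case (psubset S)
  define Z where "Z S = {b \<in> S \<rightarrow>\<^sub>E A. \<forall>a. (\<Sum>i\<in>S. of_bool (b i = a)) = (0::bit)}" for S :: "'i set"
  let ?L = "\<lambda>i. sqrt (\<Sum>a\<in>A. (F i a)\<^sup>2)"
  have finZ: "finite (Z S)" if "finite S" for S
    unfolding Z_def using that assms(1) by (intro finite_subset[OF _ finite_PiE[of S "\<lambda>_. A"]]) auto
  show ?case
  proof (cases "S = {}")
    case False
    then obtain k where k: "k \<in> S" by blast
    have "card S > 0" using k psubset.hyps by (auto simp: card_gt_0_iff)
    then have N: "N \<ge> 1" "real (card (S - {k})) \<le> N"
      using psubset.prems k psubset.hyps by auto
    define R where "R j = S - {k, j}" for j
    \<comment> \<open>The tuples in which \<open>j\<close> is a partner of \<open>k\<close>.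
      Splitting off this pair saves two factors \<open>sqrt N\<close>, hence the division by
      \<open>N\<close>; the fewer than \<open>N\<close> choices of \<open>j\<close> use it
      up.\<close>
    have one: "(\<Sum>b\<in>{b \<in> Z S. b j = b k}. \<Prod>i\<in>S. F i (b i)) \<le> (\<Prod>i\<in>S. sqrt (N * (\<Sum>a\<in>A. (F i a)\<^sup>2))) / N"
      if j: "j \<in> S - {k}" for j
    proof -
      have S: "S = insert k (insert j (R j))" "finite (R j)" "k \<notin> insert j (R j)" "j \<notin> R j"
        using j k psubset.hyps by (auto simp: R_def)
      \<comment> \<open>Forget the pair but remember its common value.\<close>
      define g where "g b = (b k, restrict b (R j))" for b :: "'i \<Rightarrow> 'a"
      let ?G = "\<lambda>(a, b). F k a * F j a * (\<Prod>i\<in>R j. F i (b i))"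
      have prodS: "(\<Prod>i\<in>S. f i) = f k * f j * (\<Prod>i\<in>R j. f i)" for f :: "'i \<Rightarrow> real"
        using S(2-4) by (subst S(1)) (simp add: mult.assoc)
      have inj: "inj_on g {b \<in> Z S. b j = b k}"
      proof (rule inj_onI)
        fix b b' assume *: "b \<in> {b \<in> Z S. b j = b k}" "b' \<in> {b \<in> Z S. b j = b k}" "g b = g b'"
        have "b i = b' i" if "i \<in> S" for i
        proof (cases "i \<in> R j")
          case True
          then show ?thesis using *(3) by (auto simp: g_def dest: fun_cong[of _ _ i])
        next
          case False
          then have "i = k \<or> i = j" using that by (auto simp: R_def)
          then show ?thesis using * by (auto simp: g_def)
        qed
        then show "b = b'"
          using * by (intro PiE_ext[of b S "\<lambda>_. A" b']) (auto simp: Z_def)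
      qed
      have sub: "g ` {b \<in> Z S. b j = b k} \<subseteq> A \<times> Z (R j)"
      proof (rule image_subsetI)
        fix b assume "b \<in> {b \<in> Z S. b j = b k}"
        then have b: "b \<in> Z S" "b j = b k" by auto
        have "(\<Sum>i\<in>R j. of_bool (restrict b (R j) i = a)) = (0::bit)" for a
        proof -
          have "(0::bit) = (\<Sum>i\<in>S. of_bool (b i = a))" using b by (simp add: Z_def)
          also have "\<dots> = of_bool (b k = a) + (of_bool (b j = a) + (\<Sum>i\<in>R j. of_bool (b i = a)))"
            using S(2-4) by (subst S(1)) simp
          also have "\<dots> = (of_bool (b k = a) + of_bool (b j = a)) + (\<Sum>i\<in>R j. of_bool (b i = a))"
            by (simp only: add.assoc)
          also have "of_bool (b k = a) + of_bool (b j = a) = (0::bit)"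
            using b(2) by (simp add: bit_add_eq_0_iff)
          finally show ?thesis by simp
        qed
        moreover have "restrict b (R j) \<in> R j \<rightarrow>\<^sub>E A" "b k \<in> A"
          using b k by (auto simp: Z_def R_def)
        ultimately show "g b \<in> A \<times> Z (R j)"
          by (auto simp: g_def Z_def)
      qed
      have "(\<Sum>b\<in>{b \<in> Z S. b j = b k}. \<Prod>i\<in>S. F i (b i)) = (\<Sum>b\<in>{b \<in> Z S. b j = b k}. ?G (g b))"
        unfolding prodS by (intro sum.cong) (auto simp: g_def)
      also have "\<dots> = sum ?G (g ` {b \<in> Z S. b j = b k})"
        by (rule sum.reindex[OF inj, unfolded o_def, symmetric])
      also have "\<dots> \<le> sum ?G (A \<times> Z (R j))"
        using sub assms(1,3) finZ[OF S(2)] by (intro sum_mono2) (auto intro!: mult_nonneg_nonneg prod_nonneg)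
      also have "\<dots> = (\<Sum>a\<in>A. F k a * F j a) * (\<Sum>b\<in>Z (R j). \<Prod>i\<in>R j. F i (b i))"
        by (simp add: sum_product sum.cartesian_product)
      also have "\<dots> \<le> (?L k * ?L j) * (\<Prod>i\<in>R j. sqrt (N * (\<Sum>a\<in>A. (F i a)\<^sup>2)))"
      proof (intro mult_mono)
        have "(\<Sum>a\<in>A. F k a * F j a) \<le> (\<Sum>a\<in>A. \<bar>F k a\<bar> * \<bar>F j a\<bar>)"
          by (intro sum_mono) (simp add: assms(3))
        also have "\<dots> \<le> ?L k * ?L j"
          using L2_set_mult_ineq[of "F k" "F j" A] by (simp add: L2_set_def)
        finally show "(\<Sum>a\<in>A. F k a * F j a) \<le> ?L k * ?L j" .
        have "R j \<subset> S" using k by (auto simp: R_def)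
        moreover have "card (R j) \<le> card S" using psubset.hyps by (intro card_mono) (auto simp: R_def)
        ultimately show "(\<Sum>b\<in>Z (R j). \<Prod>i\<in>R j. F i (b i)) \<le> (\<Prod>i\<in>R j. sqrt (N * (\<Sum>a\<in>A. (F i a)\<^sup>2)))"
          using psubset.IH[of "R j"] psubset.prems unfolding Z_def by linarith
      qed (auto intro!: mult_nonneg_nonneg sum_nonneg prod_nonneg simp: assms(3))
      also have "\<dots> = (\<Prod>i\<in>S. sqrt (N * (\<Sum>a\<in>A. (F i a)\<^sup>2))) / N"
        using N(1) unfolding prodS by (simp add: real_sqrt_mult field_simps)
      finally show ?thesis .
    qed
    have "(\<Sum>b\<in>Z S. \<Prod>i\<in>S. F i (b i)) \<le>
        (\<Sum>b\<in>(\<Union>j\<in>S - {k}. {b \<in> Z S. b j = b k}). \<Prod>i\<in>S. F i (b i))"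
    proof (rule sum_mono2)
      show "Z S \<subseteq> (\<Union>j\<in>S - {k}. {b \<in> Z S. b j = b k})"
      proof
        fix b assume b: "b \<in> Z S"
        \<comment> \<open>Index \<open>k\<close> adds 1 to the count of the value
          \<open>b k\<close>, and a zero sum requires another index to cancel it.\<close>
        have "\<exists>j\<in>S - {k}. b j = b k"
        proof (rule ccontr)
          assume none: "\<not> ?thesis"
          have "(\<Sum>i\<in>S. of_bool (b i = b k)) = (of_bool (b k = b k) + (\<Sum>i\<in>S - {k}. of_bool (b i = b k)) :: bit)"
            by (rule sum.remove[OF psubset.hyps(1) k])
          also have "(\<Sum>i\<in>S - {k}. of_bool (b i = b k)) = (0::bit)"
            using none by (intro sum.neutral) auto
          finally show False using b by (simp add: Z_def)
        qed
        then show "b \<in> (\<Union>j\<in>S - {k}. {b \<in> Z S. b j = b k})" using b by blast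
      qed
    qed (use psubset.hyps finZ in \<open>auto intro!: prod_nonneg simp: assms(3)\<close>)
    also have "\<dots> \<le> (\<Sum>j\<in>S - {k}. \<Sum>b\<in>{b \<in> Z S. b j = b k}. \<Prod>i\<in>S. F i (b i))"
      using psubset.hyps finZ by (intro sum_UN_le) (auto intro!: prod_nonneg simp: assms(3))
    also have "\<dots> \<le> (\<Sum>j\<in>S - {k}. (\<Prod>i\<in>S. sqrt (N * (\<Sum>a\<in>A. (F i a)\<^sup>2))) / N)"
      by (intro sum_mono one)
    also have "\<dots> = real (card (S - {k})) / N * (\<Prod>i\<in>S. sqrt (N * (\<Sum>a\<in>A. (F i a)\<^sup>2)))"
      by simp
    also have "\<dots> \<le> 1 * (\<Prod>i\<in>S. sqrt (N * (\<Sum>a\<in>A. (F i a)\<^sup>2)))"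
      using N by (intro mult_right_mono prod_nonneg) (auto intro!: mult_nonneg_nonneg sum_nonneg)
    finally show ?thesis unfolding Z_def by simp
  qed simp
qed

lemma char_vectors_Suc: "char_vectors s (Suc c) = (\<lambda>(a, v). a # v) ` (bit_strings s \<times> char_vectors s c)"
proof -
  have "v \<in> (\<lambda>(a, v). a # v) ` (bit_strings s \<times> char_vectors s c)" if "v \<in> char_vectors s (Suc c)" for v
    using that by (cases v) (auto simp: char_vectors_def)
  then show ?thesis by (auto simp: char_vectors_def)
qed

text \<open>Induction on the number of characters, splitting off the first one. General nonnegative
  weights are what lets the bounds be iterated; the application needs indicator weights
  only.\<close>

lemma sum_prod_zero_tuples_le:
  fixes F :: "'i \<Rightarrow> nat list \<Rightarrow> real"
  assumes "finite S" "real (card S) \<le> N" "\<And>i v. F i v \<ge> 0"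
  shows "(\<Sum>z\<in>{z \<in> S \<rightarrow>\<^sub>E char_vectors s c. \<forall>k<c. \<forall>a. (\<Sum>i\<in>S. of_bool (z i ! k = a)) = (0::bit)}. \<Prod>i\<in>S. F i (z i))
    \<le> (\<Prod>i\<in>S. sqrt (N ^ c * (\<Sum>v\<in>char_vectors s c. (F i v)\<^sup>2)))"
  using assms(3)
proof (induction c arbitrary: F)
  case 0
  have "char_vectors s 0 = {[]}" by (auto simp: char_vectors_def)
  then show ?case using 0 by (simp add: PiE_singleton)
next
  case (Suc c)
  let ?zero = "\<lambda>b. \<forall>a. (\<Sum>i\<in>S. of_bool (b i = a)) = (0::bit)"
  define Z where "Z c = {z \<in> S \<rightarrow>\<^sub>E char_vectors s c. \<forall>k<c. ?zero (\<lambda>i. z i ! k)}" for c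
  define B where "B = {b \<in> S \<rightarrow>\<^sub>E bit_strings s. ?zero b}"
  define g where "g z = (\<lambda>i\<in>S. hd (z i), \<lambda>i\<in>S. tl (z i))" for z :: "'i \<Rightarrow> nat list"
  let ?G = "\<lambda>(b, z). \<Prod>i\<in>S. F i (b i # z i)"
  have fin: "finite (Z c)" "finite B" for c
    unfolding Z_def B_def using assms(1)
    by (auto intro: finite_subset[OF _ finite_PiE[of S "\<lambda>_. char_vectors s c"]]
      finite_subset[OF _ finite_PiE[of S "\<lambda>_. bit_strings s"]])
  have N: "N \<ge> 0" using assms(2) by linarith
  have Cons: "z i = hd (z i) # tl (z i)" "hd (z i) \<in> bit_strings s" "tl (z i) \<in> char_vectors s c"
    if "z \<in> S \<rightarrow>\<^sub>E char_vectors s (Suc c)" "i \<in> S" for z i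
    using PiE_mem[OF that] by (auto simp: char_vectors_Suc)
  have inj: "inj_on g (Z (Suc c))"
  proof (rule inj_onI)
    fix z z' assume *: "z \<in> Z (Suc c)" "z' \<in> Z (Suc c)" "g z = g z'"
    have "z i = z' i" if "i \<in> S" for i
    proof -
      have "hd (z i) = hd (z' i)" "tl (z i) = tl (z' i)"
        using arg_cong[OF *(3), of "\<lambda>p. fst p i"] arg_cong[OF *(3), of "\<lambda>p. snd p i"] that
        by (simp_all add: g_def)
      moreover have "z \<in> S \<rightarrow>\<^sub>E char_vectors s (Suc c)" "z' \<in> S \<rightarrow>\<^sub>E char_vectors s (Suc c)"
        using * by (auto simp: Z_def)
      ultimately show ?thesis using Cons(1)[OF _ that] by metis
    qed
    then show "z = z'"
      using * by (intro PiE_ext[of z S "\<lambda>_. char_vectors s (Suc c)" z']) (auto simp: Z_def)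
  qed
  have sub: "g ` Z (Suc c) \<subseteq> B \<times> Z c"
  proof (rule image_subsetI)
    fix z assume "z \<in> Z (Suc c)"
    then have z: "z \<in> S \<rightarrow>\<^sub>E char_vectors s (Suc c)" "\<And>k. k < Suc c \<Longrightarrow> ?zero (\<lambda>i. z i ! k)"
      by (auto simp: Z_def)
    have eq: "(\<Sum>i\<in>S. of_bool (hd (z i) = a)) = (\<Sum>i\<in>S. of_bool (z i ! 0 = a) :: bit)"
      "(\<Sum>i\<in>S. of_bool (tl (z i) ! k = a)) = (\<Sum>i\<in>S. of_bool (z i ! Suc k = a) :: bit)" for a k
      by (intro sum.cong refl; metis Cons(1)[OF z(1)] nth_Cons_0 nth_Cons_Suc)+
    have "?zero (\<lambda>i. hd (z i))" "k < c \<Longrightarrow> ?zero (\<lambda>i. tl (z i) ! k)" for k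
      unfolding eq using z(2) by blast+
    then show "g z \<in> B \<times> Z c"
      using Cons(2,3)[OF z(1)] by (simp add: g_def B_def Z_def del: sum_of_bool_eq cong: sum.cong)
  qed
  have "(\<Sum>z\<in>Z (Suc c). \<Prod>i\<in>S. F i (z i)) = (\<Sum>z\<in>Z (Suc c). ?G (g z))"
    by (intro sum.cong prod.cong refl) (auto simp: g_def Z_def Cons(1)[symmetric] intro!: prod.cong)
  also have "\<dots> = sum ?G (g ` Z (Suc c))"
    by (rule sum.reindex[OF inj, unfolded o_def, symmetric])
  also have "\<dots> \<le> sum ?G (B \<times> Z c)"
    using sub fin by (intro sum_mono2) (auto intro!: prod_nonneg Suc.prems)
  also have "\<dots> = (\<Sum>b\<in>B. \<Sum>z\<in>Z c. \<Prod>i\<in>S. F i (b i # z i))"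
    by (simp add: sum.cartesian_product)
  also have "\<dots> \<le> (\<Sum>b\<in>B. \<Prod>i\<in>S. sqrt (N ^ c * (\<Sum>v\<in>char_vectors s c. (F i (b i # v))\<^sup>2)))"
    unfolding Z_def by (intro sum_mono Suc.IH Suc.prems)
  \<comment> \<open>For fixed first characters \<open>b\<close>, the bound on the tails is again a
    product of nonnegative weights, each depending only on \<open>b i\<close>. So the case of one
    character applies to these weights.\<close>
  also have "\<dots> \<le> (\<Prod>i\<in>S. sqrt (N * (\<Sum>a\<in>bit_strings s.
      (sqrt (N ^ c * (\<Sum>v\<in>char_vectors s c. (F i (a # v))\<^sup>2)))\<^sup>2)))"
    unfolding B_def using assms(1,2) N
    by (intro sum_prod_zero_tuples_one_char_le) (auto intro!: mult_nonneg_nonneg sum_nonneg)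
  also have "\<dots> = (\<Prod>i\<in>S. sqrt (N ^ Suc c * (\<Sum>v\<in>char_vectors s (Suc c). (F i v)\<^sup>2)))"
  proof (intro prod.cong refl arg_cong[of _ _ sqrt])
    fix i
    have "(\<Sum>a\<in>bit_strings s. (sqrt (N ^ c * (\<Sum>v\<in>char_vectors s c. (F i (a # v))\<^sup>2)))\<^sup>2) =
        (\<Sum>a\<in>bit_strings s. N ^ c * (\<Sum>v\<in>char_vectors s c. (F i (a # v))\<^sup>2))"
      using N by (intro sum.cong refl real_sqrt_pow2 mult_nonneg_nonneg sum_nonneg) auto
    also have "\<dots> = N ^ c * (\<Sum>(a, v)\<in>bit_strings s \<times> char_vectors s c. (F i (a # v))\<^sup>2)"
      by (simp add: sum.cartesian_product flip: sum_distrib_left)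
    also have "(\<Sum>(a, v)\<in>bit_strings s \<times> char_vectors s c. (F i (a # v))\<^sup>2) =
        (\<Sum>v\<in>char_vectors s (Suc c). (F i v)\<^sup>2)"
      unfolding char_vectors_Suc by (subst sum.reindex) (auto simp: inj_on_def o_def case_prod_unfold)
    finally show "N * (\<Sum>a\<in>bit_strings s. (sqrt (N ^ c * (\<Sum>v\<in>char_vectors s c. (F i (a # v))\<^sup>2)))\<^sup>2) =
        N ^ Suc c * (\<Sum>v\<in>char_vectors s (Suc c). (F i v)\<^sup>2)"
      by simp
  qed
  finally show ?case unfolding Z_def .
qed

text \<open>With the indicator of \<open>V\<close> as weight, each of the \<open>2 * t\<close>
  factors is \<open>sqrt (N ^ c * card V)\<close>: cancelling costs half of the degrees of freedom
  on \<open>S\<close>. The coordinates outside \<open>S\<close> are free.\<close>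

lemma card_zero_subtuples_le:
  assumes "finite I" "S \<subseteq> I" "card S = 2 * t" "2 * t \<le> N" "V \<subseteq> char_vectors s c"
  shows "card {z \<in> I \<rightarrow>\<^sub>E V. \<forall>e\<in>{..<c} \<times> bit_strings s. (\<Sum>i\<in>S. char_ind (z i) e) = 0}
    \<le> N ^ (c * t) * card V ^ t * card V ^ (card I - 2 * t)"
proof -
  define Z where "Z = {z \<in> S \<rightarrow>\<^sub>E char_vectors s c. \<forall>k<c. \<forall>a. (\<Sum>i\<in>S. of_bool (z i ! k = a)) = (0::bit)}"
  have finS: "finite S" and finV: "finite V"
    using assms finite_subset finite_char_vectors by blast+
  have finZ: "finite Z"
    unfolding Z_def using finS by (intro finite_subset[OF _ finite_PiE[of S "\<lambda>_. char_vectors s c"]]) auto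
  define F where "F = (\<lambda>(i::'a) v. of_bool (v \<in> V) :: real)"
  define D where "D = {z \<in> I \<rightarrow>\<^sub>E V. \<forall>e\<in>{..<c} \<times> bit_strings s. (\<Sum>i\<in>S. char_ind (z i) e) = 0}"
  define g where "g z = (restrict z S, restrict z (I - S))" for z :: "'a \<Rightarrow> nat list"
  have "real (card {z \<in> Z. \<forall>i\<in>S. z i \<in> V}) = (\<Sum>z\<in>Z. of_bool (\<forall>i\<in>S. z i \<in> V))"
    using finZ by (simp add: Int_def)
  also have "\<dots> = (\<Sum>z\<in>Z. \<Prod>i\<in>S. F i (z i))"
    using finS by (intro sum.cong refl) (auto simp: F_def)
  also have "\<dots> \<le> (\<Prod>i\<in>S. sqrt (real N ^ c * (\<Sum>v\<in>char_vectors s c. (F i v)\<^sup>2)))"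
    unfolding Z_def using finS assms(3,4) by (intro sum_prod_zero_tuples_le) (auto simp: F_def)
  also have "\<dots> = sqrt (real N ^ c * card V) ^ (2 * t)"
  proof -
    have "(\<Sum>v\<in>char_vectors s c. (F i v)\<^sup>2) = real (card V)" for i
    proof -
      have "(\<Sum>v\<in>char_vectors s c. (F i v)\<^sup>2) = (\<Sum>v\<in>char_vectors s c. of_bool (v \<in> V))"
        by (intro sum.cong) (auto simp: F_def)
      also have "\<dots> = real (card V)"
        using assms(5) by (simp add: Int_absorb1)
      finally show ?thesis .
    qed
    then show ?thesis using assms(3) by simp
  qed
  also have "\<dots> = real (N ^ (c * t) * card V ^ t)"
    by (simp add: power_mult power_mult_distrib)
  finally have Z: "card {z \<in> Z. \<forall>i\<in>S. z i \<in> V} \<le> N ^ (c * t) * card V ^ t"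
    by (simp only: of_nat_le_iff)
  have "inj_on g D"
  proof (rule inj_onI)
    fix z z' assume *: "z \<in> D" "z' \<in> D" "g z = g z'"
    have "z i = z' i" if "i \<in> I" for i
      using *(3) that by (cases "i \<in> S") (auto simp: g_def dest: fun_cong[of _ _ i])
    then show "z = z'"
      using * by (intro PiE_ext[of z I "\<lambda>_. V" z']) (auto simp: D_def)
  qed
  moreover have "g ` D \<subseteq> {z \<in> Z. \<forall>i\<in>S. z i \<in> V} \<times> ((I - S) \<rightarrow>\<^sub>E V)"
  proof (rule image_subsetI)
    fix z assume z: "z \<in> D"
    then have zV: "z \<in> I \<rightarrow>\<^sub>E V" by (simp add: D_def)
    have "(\<Sum>i\<in>S. of_bool (z i ! k = a)) = (0::bit)" if "k < c" for k a
    proof (cases "a \<in> bit_strings s")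
      case True
      then show ?thesis using z that by (auto simp: D_def char_ind_def simp del: sum_of_bool_eq)
    next
      case False
      \<comment> \<open>Membership in \<open>D\<close> speaks of characters in the alphabet only;
        all others never occur.\<close>
      have "z i ! k \<noteq> a" if "i \<in> S" for i
      proof -
        have "z i \<in> char_vectors s c" using zV assms(2,5) that by auto
        then show ?thesis using \<open>k < c\<close> False nth_mem by (fastforce simp: char_vectors_def)
      qed
      then show ?thesis by (intro sum.neutral) auto
    qed
    then show "g z \<in> {z \<in> Z. \<forall>i\<in>S. z i \<in> V} \<times> ((I - S) \<rightarrow>\<^sub>E V)"
      using zV assms(2,5) by (auto simp: g_def Z_def subset_iff PiE_iff simp del: sum_of_bool_eq cong: sum.cong)
  qed
  ultimately have "card D \<le> card ({z \<in> Z. \<forall>i\<in>S. z i \<in> V} \<times> ((I - S) \<rightarrow>\<^sub>E V))"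
    using finZ finV assms(1) by (intro card_inj_on_le[where f = g]) (auto intro!: finite_PiE)
  also have "\<dots> = card {z \<in> Z. \<forall>i\<in>S. z i \<in> V} * card V ^ (card I - 2 * t)"
    using assms(1-3) finS by (simp add: card_cartesian_product card_PiE card_Diff_subset)
  also have "\<dots> \<le> N ^ (c * t) * card V ^ t * card V ^ (card I - 2 * t)"
    by (intro mult_right_mono Z) auto
  finally show ?thesis by (simp add: D_def)
qed

section \<open>Walks\<close>

text \<open>Step \<open>p\<close> of a walk \<open>z\<close> asks that \<open>z p\<close> and \<open>z (Suc p)\<close> agree in the first or the second of
  two derived characters, alternatingly; it is dependent if the steps before it with the same parity
  imply this for all tables.\<close>

definition step_dep :: "nat \<Rightarrow> nat \<Rightarrow> (nat \<Rightarrow> nat list) \<Rightarrow> nat \<Rightarrow> bool" where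
  "step_dep c s z p \<longleftrightarrow> (\<exists>J\<subseteq>{q. q < p \<and> q mod 2 = p mod 2}. \<forall>e\<in>{..<c} \<times> bit_strings s.
     char_ind (z p) e + char_ind (z (Suc p)) e = (\<Sum>q\<in>J. char_ind (z q) e + char_ind (z (Suc q)) e))"

definition free_walk :: "nat \<Rightarrow> nat \<Rightarrow> (nat \<Rightarrow> nat list) \<Rightarrow> nat \<Rightarrow> bool" where
  "free_walk c s z n \<longleftrightarrow> (\<forall>p<n. \<not> step_dep c s z p)"

text \<open>Pair \<open>k\<close> consists of the derived characters \<open>2 * k\<close> and
  \<open>2 * k + 1\<close>. The steps are reversed because \<open>indep_eqs\<close> expects the
  newest equation first.\<close>

definition walk_eqs :: "nat \<Rightarrow> (nat \<Rightarrow> nat list) \<Rightarrow> nat \<Rightarrow> (nat \<times> nat list \<times> nat list) list" where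
  "walk_eqs k z n = map (\<lambda>p. (2 * k + p mod 2, z p, z (Suc p))) (rev [0..<n])"

lemma step_dep_cong: "(\<And>i. i \<le> Suc p \<Longrightarrow> z i = z' i) \<Longrightarrow> step_dep c s z p \<longleftrightarrow> step_dep c s z' p"
  unfolding step_dep_def by (intro ex_cong1 conj_cong refl ball_cong arg_cong2[of _ _ _ _ "(=)"]
    sum.cong arg_cong2[of _ _ _ _ "(+)"]) (auto simp: subset_iff)

lemma free_walk_cong: "(\<And>i. i \<le> n \<Longrightarrow> z i = z' i) \<Longrightarrow> free_walk c s z n \<longleftrightarrow> free_walk c s z' n"
  unfolding free_walk_def by (intro all_cong arg_cong[of _ _ Not] step_dep_cong) auto

text \<open>If a step is not dependent, its difference vector is outside the span of those of the
  earlier steps of the same parity, and the linear alternative supplies the functional that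
  \<open>indep_eqs\<close> asks for.\<close>

lemma indep_walk_eqs:
  assumes "free_walk c s z n" "\<And>i. i \<le> n \<Longrightarrow> z i \<in> char_vectors s c"
  shows "indep_eqs (walk_eqs k z n)"
  using assms
proof (induction n)
  case (Suc n)
  let ?A = "{..<c} \<times> bit_strings s"
  let ?d = "\<lambda>q e. char_ind (z q) e + char_ind (z (Suc q)) e"
  let ?I = "{q. q < n \<and> q mod 2 = n mod 2}"
  have ip: "(\<Sum>e\<in>?A. W e * ?d q e) = entry_sum W (z q) + entry_sum W (z (Suc q))" if "q \<le> n" for W q
    using Suc.prems(2) that by (simp add: distrib_left sum.distrib sum_char_ind_eq_entry_sum)
  have dep: "\<not> (\<exists>J\<subseteq>?I. \<forall>e\<in>?A. ?d n e = (\<Sum>q\<in>J. ?d q e))"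
    using Suc.prems(1) unfolding free_walk_def step_dep_def by blast
  then obtain W where W: "\<forall>q\<in>?I. (\<Sum>e\<in>?A. W e * ?d q e) = 0" "(\<Sum>e\<in>?A. W e * ?d n e) = 1"
  proof -
    have "finite ?A" "finite ?I" by simp_all
    then have "(\<exists>J\<subseteq>?I. \<forall>e\<in>?A. ?d n e = (\<Sum>q\<in>J. ?d q e)) \<or>
        (\<exists>W. (\<forall>q\<in>?I. (\<Sum>e\<in>?A. W e * ?d q e) = 0) \<and> (\<Sum>e\<in>?A. W e * ?d n e) = 1)"
      by (rule F2_span_or_separated)
    then show thesis using dep that by blast
  qed
  have "entry_sum W (z n) \<noteq> entry_sum W (z (Suc n))"
    using W(2) ip[of n W] by (simp add: bit_add_eq_1_iff)
  moreover have "entry_sum W (z q) = entry_sum W (z (Suc q))" if "q \<in> ?I" for q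
    using W(1) that ip[of q W] by (simp add: bit_add_eq_0_iff)
  moreover have "indep_eqs (walk_eqs k z n)"
    using Suc by (simp add: free_walk_def)
  ultimately show ?case
    by (auto simp: walk_eqs_def)
qed (simp add: walk_eqs_def)

text \<open>The first component counts the independent steps, and thereby the factors
  \<open>1 / 2 ^ s\<close> in the probability. It is \<open>L\<close> for a walk that stays free
  throughout; otherwise the walk ends with one further, dependent step, whose equation is not
  counted because it is implied. The endpoints of that step must differ, as a trivial step would be
  dependent for free.\<close>

definition walk_witnesses :: "nat \<Rightarrow> nat \<Rightarrow> nat list set \<Rightarrow> nat \<Rightarrow> (nat \<times> (nat \<Rightarrow> nat list)) set" where
  "walk_witnesses c s V L =
     {L} \<times> {z \<in> {..L} \<rightarrow>\<^sub>E V. free_walk c s z L} \<union>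
     (SIGMA p:{..<L}. {z \<in> {..Suc p} \<rightarrow>\<^sub>E V. free_walk c s z p \<and> step_dep c s z p \<and> z p \<noteq> z (Suc p)})"

lemma walk_witnesses_mono: "Y \<subseteq> V \<Longrightarrow> walk_witnesses c s Y L \<subseteq> walk_witnesses c s V L"
  unfolding walk_witnesses_def by (auto simp: PiE_iff)

lemma finite_walk_witnesses: "finite V \<Longrightarrow> finite (walk_witnesses c s V L)"
  unfolding walk_witnesses_def
  by (intro finite_UnI finite_SigmaI finite_cartesian_product finite_Collect_conjI disjI1) (auto simp: finite_PiE)

lemma walk_witnessesD:
  assumes "(n, z) \<in> walk_witnesses c s V L"
  shows "free_walk c s z n" "\<And>i. i \<le> n \<Longrightarrow> z i \<in> V"
  using assms by (auto simp: walk_witnesses_def)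

text \<open>Inside a core a walk never gets stuck, so it can be extended until a step is dependent
  or \<open>L\<close> steps are made. The function \<open>g\<close> stands for the two derived
  characters of one pair.\<close>

lemma walk_witness_exists:
  fixes g :: "nat \<Rightarrow> nat list \<Rightarrow> 'b"
  assumes "x \<in> Y" and core: "\<And>v b. v \<in> Y \<Longrightarrow> b < 2 \<Longrightarrow> \<exists>v'\<in>Y. v' \<noteq> v \<and> g b v = g b v'"
  shows "\<exists>n z. (n, z) \<in> walk_witnesses c s Y L \<and> z 0 = x \<and>
    (\<forall>p<n. g (p mod 2) (z p) = g (p mod 2) (z (Suc p)))"
proof (induction L)
  case 0
  have "(0, \<lambda>i\<in>{..0}. x) \<in> walk_witnesses c s Y 0"
    using assms(1) by (auto simp: walk_witnesses_def free_walk_def)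
  moreover have "(\<lambda>i\<in>{..0::nat}. x) 0 = x" by simp
  ultimately show ?case by blast
next
  case (Suc L)
  then obtain n z where nz: "(n, z) \<in> walk_witnesses c s Y L" "z 0 = x"
    "\<And>p. p < n \<Longrightarrow> g (p mod 2) (z p) = g (p mod 2) (z (Suc p))" by blast
  show ?case
  proof (cases "n = L")
    case False
    \<comment> \<open>Here \<open>n < L\<close>: the walk has already ended in a dependent step and
      needs no extension.\<close>
    then have "(n, z) \<in> walk_witnesses c s Y (Suc L)"
      using nz(1) by (auto simp: walk_witnesses_def)
    then show ?thesis using nz by blast
  next
    case True
    then have z: "z \<in> {..L} \<rightarrow>\<^sub>E Y" "free_walk c s z L"
      using nz(1) by (auto simp: walk_witnesses_def)
    have "z L \<in> Y" using z(1) by auto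
    then obtain y where y: "y \<in> Y" "y \<noteq> z L" "g (L mod 2) (z L) = g (L mod 2) y"
      using core[of "z L" "L mod 2"] by auto
    define z' where "z' = z(Suc L := y)"
    have z': "z' \<in> {..Suc L} \<rightarrow>\<^sub>E Y" "z' 0 = x" "z' L \<noteq> z' (Suc L)"
      using z(1) y nz(2) by (auto simp: z'_def PiE_iff extensional_def le_Suc_eq)
    have eqs: "g (p mod 2) (z' p) = g (p mod 2) (z' (Suc p))" if "p < Suc L" for p
      using that nz(3) y True by (cases "p = L") (auto simp: z'_def)
    have free: "free_walk c s z' L"
      using z(2) free_walk_cong[of L z z' c s] by (simp add: z'_def)
    show ?thesis
    proof (cases "step_dep c s z' L")
      case True
      then have "(L, z') \<in> walk_witnesses c s Y (Suc L)"
        using z' free by (auto simp: walk_witnesses_def)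
      then show ?thesis using z'(2) eqs less_SucI by blast
    next
      case False
      then have "(Suc L, z') \<in> walk_witnesses c s Y (Suc L)"
        using z' free by (auto simp: walk_witnesses_def free_walk_def less_Suc_eq)
      then show ?thesis using z'(2) eqs by blast
    qed
  qed
qed

lemma char_ind_inj:
  assumes "v \<in> char_vectors s c" "w \<in> char_vectors s c"
    and "\<And>e. e \<in> {..<c} \<times> bit_strings s \<Longrightarrow> char_ind v e = char_ind w e"
  shows "v = w"
proof (rule nth_equalityI)
  show "length v = length w" using assms(1,2) by (simp add: char_vectors_def)
  fix i assume "i < length v"
  then have "i < c" "v ! i \<in> bit_strings s" using assms(1) by (auto simp: char_vectors_def)
  then show "v ! i = w ! i" using assms(3)[of "(i, v ! i)"] by (auto simp: char_ind_def split: if_splits)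
qed

text \<open>If step \<open>p\<close> depends on the steps in \<open>J\<close>, then the
  \<open>2 * (card J + 1)\<close> endpoints of all these steps cancel in every character. The bound
  for cancelling subtuples then applies for each \<open>J\<close>.\<close>

lemma card_dep_walks_le:
  assumes "V \<subseteq> char_vectors s c"
  shows "card {z \<in> {..Suc p} \<rightarrow>\<^sub>E V. step_dep c s z p \<and> z p \<noteq> z (Suc p)} \<le>
    (\<Sum>J\<in>Pow {q. q < p \<and> q mod 2 = p mod 2} - {{}}.
       (p + 2) ^ (c * (card J + 1)) * card V ^ (card J + 1) * card V ^ (p - 2 * card J))"
proof -
  let ?I = "{q. q < p \<and> q mod 2 = p mod 2}"
  let ?A = "{..<c} \<times> bit_strings s"
  define S where "S J = (\<Union>q\<in>insert p J. {q, Suc q})" for J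
  define D where "D J = {z \<in> {..Suc p} \<rightarrow>\<^sub>E V. \<forall>e\<in>?A. (\<Sum>i\<in>S J. char_ind (z i) e) = 0}" for J
  have finV: "finite V" using assms finite_subset finite_char_vectors by blast
  have fin: "finite (D J)" for J
    unfolding D_def using finV by (intro finite_Collect_conjI disjI1) (simp add: finite_PiE)
  have S: "S J \<subseteq> {..Suc p}" "card (S J) = 2 * (card J + 1)"
    "\<And>f. sum f (S J) = (\<Sum>q\<in>insert p J. f q + (f (Suc q) :: bit))" if "J \<subseteq> ?I" for J
  proof -
    have J: "finite J" "p \<notin> J" "\<forall>q\<in>insert p J. q \<le> p \<and> q mod 2 = p mod 2"
      using that finite_subset[OF that] by auto
    then show "S J \<subseteq> {..Suc p}" by (auto simp: S_def)
    \<comment> \<open>Distinct steps of equal parity are at least two apart, so no endpoint is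
      shared.\<close>
    have disj: "\<forall>q\<in>insert p J. \<forall>r\<in>insert p J. q \<noteq> r \<longrightarrow> {q, Suc q} \<inter> {r, Suc r} = {}"
    proof (intro ballI impI)
      fix q r assume "q \<in> insert p J" "r \<in> insert p J" "q \<noteq> r"
      then have "q mod 2 = r mod 2" "q \<noteq> r" using J(3) by metis+
      then have "q \<noteq> Suc r" "r \<noteq> Suc q" by presburger+
      then show "{q, Suc q} \<inter> {r, Suc r} = {}" using \<open>q \<noteq> r\<close> by auto
    qed
    have "card (S J) = (\<Sum>q\<in>insert p J. card {q, Suc q})"
      unfolding S_def using J disj by (intro card_UN_disjoint) auto
    then show "card (S J) = 2 * (card J + 1)" using J by simp
    show "sum f (S J) = (\<Sum>q\<in>insert p J. f q + f (Suc q))" for f :: "nat \<Rightarrow> bit"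
      unfolding S_def using J disj by (subst sum.UNION_disjoint) auto
  qed
  have "{z \<in> {..Suc p} \<rightarrow>\<^sub>E V. step_dep c s z p \<and> z p \<noteq> z (Suc p)} \<subseteq> (\<Union>J\<in>Pow ?I - {{}}. D J)"
  proof
    fix z assume "z \<in> {z \<in> {..Suc p} \<rightarrow>\<^sub>E V. step_dep c s z p \<and> z p \<noteq> z (Suc p)}"
    then have z: "z \<in> {..Suc p} \<rightarrow>\<^sub>E V" "step_dep c s z p" "z p \<noteq> z (Suc p)" by simp_all
    then obtain J where J: "J \<subseteq> ?I" "\<And>e. e \<in> ?A \<Longrightarrow>
        char_ind (z p) e + char_ind (z (Suc p)) e = (\<Sum>q\<in>J. char_ind (z q) e + char_ind (z (Suc q)) e)"
      unfolding step_dep_def by blast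
    \<comment> \<open>Otherwise the incidence vectors of \<open>z p\<close> and
      \<open>z (Suc p)\<close> agree, so the keys do. Hence at least four keys cancel, which later
      saves the decisive factor \<open>n / m\<close>.\<close>
    have "J \<noteq> {}"
    proof
      assume "J = {}"
      then have "char_ind (z p) e = char_ind (z (Suc p)) e" if "e \<in> ?A" for e
        using J(2)[OF that] by (simp add: bit_add_eq_0_iff)
      moreover have "z p \<in> V" "z (Suc p) \<in> V" using z(1) by auto
      ultimately show False using char_ind_inj z(3) assms by blast
    qed
    moreover have "(\<Sum>i\<in>S J. char_ind (z i) e) = 0" if "e \<in> ?A" for e
    proof -
      have "finite J" "p \<notin> J" using J(1) finite_subset[OF J(1)] by auto
      then have "(\<Sum>i\<in>S J. char_ind (z i) e) = (char_ind (z p) e + char_ind (z (Suc p)) e) +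
          (\<Sum>q\<in>J. char_ind (z q) e + char_ind (z (Suc q)) e)"
        unfolding S(3)[OF J(1)] by simp
      then show ?thesis using J(2)[OF that] bit_add_eq_0_iff by metis
    qed
    ultimately have "z \<in> D J" "J \<in> Pow ?I - {{}}"
      using J(1) z(1) by (auto simp: D_def)
    then show "z \<in> (\<Union>J\<in>Pow ?I - {{}}. D J)" by blast
  qed
  then have "card {z \<in> {..Suc p} \<rightarrow>\<^sub>E V. step_dep c s z p \<and> z p \<noteq> z (Suc p)} \<le>
      card (\<Union>J\<in>Pow ?I - {{}}. D J)"
    using fin by (intro card_mono) auto
  also have "\<dots> \<le> (\<Sum>J\<in>Pow ?I - {{}}. card (D J))"
    by (rule card_UN_le) simp
  also have "\<dots> \<le> (\<Sum>J\<in>Pow ?I - {{}}.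
       (p + 2) ^ (c * (card J + 1)) * card V ^ (card J + 1) * card V ^ (p - 2 * card J))"
  proof (rule sum_mono)
    fix J assume "J \<in> Pow ?I - {{}}"
    then have J: "J \<subseteq> ?I" by blast
    \<comment> \<open>The walk has \<open>p + 2\<close> vertices, so \<open>p - 2 * card J\<close>
      of them are left free.\<close>
    have "2 * (card J + 1) \<le> p + 2"
      using card_mono[OF _ S(1)[OF J]] S(2)[OF J] by simp
    then have "card (D J) \<le> (p + 2) ^ (c * (card J + 1)) * card V ^ (card J + 1) *
        card V ^ (card {..Suc p} - 2 * (card J + 1))"
      unfolding D_def by (intro card_zero_subtuples_le S[OF J] assms) auto
    then show "card (D J) \<le> (p + 2) ^ (c * (card J + 1)) * card V ^ (card J + 1) * card V ^ (p - 2 * card J)"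
      by simp
  qed
  finally show ?thesis .
qed

section \<open>Estimates for the total weight of the walks\<close>

lemma power_le_exponential:
  fixes r :: real
  assumes "r > 1" "k > 0"
  shows "\<exists>K>0. \<forall>p. (real p + 2) ^ k \<le> K * r ^ p"
proof (intro exI conjI allI)
  define a where "a = ln r"
  have a: "a > 0" using assms by (simp add: a_def)
  show "real k ^ k * r\<^sup>2 / a ^ k > 0"
    using assms a by simp
  fix p :: nat
  \<comment> \<open>The bound \<open>(1 + x / k) ^ k \<le> exp x\<close> with
    \<open>x = a * (p + 2)\<close>, where \<open>exp a = r\<close>.\<close>
  have "(a * (real p + 2) / k) ^ k \<le> (1 + a * (real p + 2) / k) ^ k"
    using a by (intro power_mono) (auto intro!: divide_nonneg_nonneg mult_nonneg_nonneg)
  also have "\<dots> \<le> exp (a * (real p + 2))"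
    using a assms(2) by (intro exp_ge_one_plus_x_over_n_power_n) (auto intro: order.trans[of _ 0])
  also have "\<dots> = exp (real (p + 2) * ln r)"
    by (simp add: a_def mult.commute)
  also have "\<dots> = r ^ (p + 2)"
    using assms(1) by (subst exp_of_nat_mult) simp
  finally have "a ^ k * (real p + 2) ^ k \<le> r ^ (p + 2) * real k ^ k"
    using assms(2) by (simp only: power_divide power_mult_distrib pos_divide_le_eq zero_less_power of_nat_0_less_iff)
  then show "(real p + 2) ^ k \<le> real k ^ k * r\<^sup>2 / a ^ k * r ^ p"
    using a by (simp add: field_simps power2_eq_square)
qed

lemma sum_Pow_power_card:
  fixes y :: real
  assumes "finite I"
  shows "(\<Sum>J\<in>Pow I. y ^ card J) = (1 + y) ^ card I"
proof -
  have "(\<Prod>x\<in>I. y + 1) = (\<Sum>X\<in>Pow I. (\<Prod>x\<in>X. y) * (\<Prod>x\<in>I - X. 1))"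
    by (rule prod_add) (fact assms)
  then show ?thesis by (simp add: add.commute)
qed

text \<open>Distinguish an element \<open>a\<close> of each nonempty \<open>J\<close>; removing it
  leaves a full binomial sum, and there are \<open>card I\<close> choices of
  \<open>a\<close>.\<close>

lemma sum_nonempty_Pow_power_card_le:
  fixes y :: real
  assumes "finite I" "y \<ge> 0"
  shows "(\<Sum>J\<in>Pow I - {{}}. y ^ (card J - 1)) \<le> card I * (1 + y) ^ card I"
proof -
  have "(\<Sum>J\<in>Pow I - {{}}. y ^ (card J - 1)) \<le> (\<Sum>J\<in>(\<Union>a\<in>I. insert a ` Pow (I - {a})). y ^ (card J - 1))"
  proof (rule sum_mono2)
    show "Pow I - {{}} \<subseteq> (\<Union>a\<in>I. insert a ` Pow (I - {a}))"
    proof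
      fix J assume "J \<in> Pow I - {{}}"
      then obtain a where "a \<in> J" "J \<subseteq> I" by blast
      then have "J = insert a (J - {a})" "J - {a} \<in> Pow (I - {a})" "a \<in> I" by auto
      then show "J \<in> (\<Union>a\<in>I. insert a ` Pow (I - {a}))" by blast
    qed
  qed (use assms in auto)
  also have "\<dots> \<le> (\<Sum>a\<in>I. \<Sum>J\<in>insert a ` Pow (I - {a}). y ^ (card J - 1))"
    using assms by (intro sum_UN_le) auto
  also have "\<dots> \<le> (\<Sum>a\<in>I. (1 + y) ^ card I)"
  proof (rule sum_mono)
    fix a assume a: "a \<in> I"
    have "inj_on (insert a) (Pow (I - {a}))" by (auto intro!: inj_onI)
    then have "(\<Sum>J\<in>insert a ` Pow (I - {a}). y ^ (card J - 1)) =
        (\<Sum>J\<in>Pow (I - {a}). y ^ (card (insert a J) - 1))"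
      by (subst sum.reindex) auto
    also have "\<dots> = (\<Sum>J\<in>Pow (I - {a}). y ^ card J)"
    proof (intro sum.cong refl)
      fix J assume "J \<in> Pow (I - {a})"
      then have "finite J" "a \<notin> J" using assms(1) finite_subset by auto
      then show "y ^ (card (insert a J) - 1) = y ^ card J" by simp
    qed
    also have "\<dots> = (1 + y) ^ card (I - {a})"
      using assms(1) by (simp add: sum_Pow_power_card)
    also have "\<dots> \<le> (1 + y) ^ card I"
      using assms by (intro power_increasing) (auto intro: card_mono)
    finally show "(\<Sum>J\<in>insert a ` Pow (I - {a}). y ^ (card J - 1)) \<le> (1 + y) ^ card I" .
  qed
  finally show ?thesis by simp
qed

lemma card_same_parity_le:
  assumes "J \<subseteq> {q. q < p \<and> q mod 2 = p mod (2::nat)}"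
  shows "2 * card J \<le> p"
proof -
  have fin: "finite J" using assms finite_subset by fastforce
  have "J \<inter> Suc ` J = {}"
  proof (rule ccontr)
    assume "J \<inter> Suc ` J \<noteq> {}"
    then obtain q where "q \<in> J" "Suc q \<in> J" by blast
    then have "q mod 2 = p mod 2" "Suc q mod 2 = p mod 2" using assms by blast+
    then show False by presburger
  qed
  moreover have "J \<union> Suc ` J \<subseteq> {..<p}"
  proof -
    have "Suc q < p" if "q < p" "q mod 2 = p mod 2" for q
      using that by presburger
    then show ?thesis using assms by auto
  qed
  ultimately have "card J + card (Suc ` J) \<le> p"
    using card_mono[of "{..<p}" "J \<union> Suc ` J"] fin by (simp add: card_Un_disjoint)
  then show ?thesis by (simp add: card_image)
qed

text \<open>The left side contains \<open>n\<close> to the power \<open>p - j + 1\<close> and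
  \<open>m\<close> to the power \<open>-p\<close>. After one factor \<open>n / m\<close> and the
  factors \<open>1 / m\<close> left for the remaining \<open>j - 1\<close> elements of the
  dependency, \<open>(n / m) ^ (p - j)\<close> is left over, and \<open>p - j\<close> is at least
  \<open>p / 2\<close>.\<close>

lemma dep_walk_term_le:
  fixes m n B \<theta> :: real
  assumes "m > 0" "0 \<le> n" "n / m \<le> \<theta>" "\<theta> \<le> 1" "B \<ge> 0" "j \<ge> 1" "2 * j \<le> p"
  shows "B ^ (j + 1) * n ^ (j + 1) * n ^ (p - 2 * j) * (1 / m) ^ p \<le>
    n / m * B\<^sup>2 * sqrt \<theta> ^ p * (B / m) ^ (j - 1)"
proof -
  obtain i where j: "j = Suc i" using assms(6) by (cases j) auto
  obtain k where p: "p = 2 * j + k" using assms(7) le_Suc_ex by blast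
  have \<theta>: "0 \<le> \<theta>" using assms divide_nonneg_pos[of n m] by linarith
  have "B ^ (j + 1) * n ^ (j + 1) * n ^ (p - 2 * j) * (1 / m) ^ p =
      n / m * B\<^sup>2 * (B / m) ^ (j - 1) * (n / m) ^ (p - j)"
    unfolding p unfolding j using assms(1)
    by (simp add: field_simps power_add power2_eq_square power_mult)
  also have "\<dots> \<le> n / m * B\<^sup>2 * (B / m) ^ (j - 1) * sqrt \<theta> ^ p"
  proof (rule mult_left_mono)
    have "(n / m) ^ (p - j) \<le> \<theta> ^ (p - j)"
      using assms by (intro power_mono) auto
    also have "\<dots> = sqrt \<theta> ^ (2 * (p - j))"
      using \<theta> by (simp add: power_mult)
    also have "\<dots> \<le> sqrt \<theta> ^ p"
      using \<theta> assms(4,7) by (intro power_decreasing) auto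
    finally show "(n / m) ^ (p - j) \<le> sqrt \<theta> ^ p" .
  qed (use assms in auto)
  finally show ?thesis by (simp add: mult_ac)
qed

text \<open>The weight of a witness is the probability of its independent steps, so this bounds the
  expected number of witnesses. The two conditions on \<open>L\<close> make it the least exponent
  with \<open>2 ^ s \<le> (1 + \<epsilon>) ^ L\<close>: long enough for free walks to be rare, short
  enough for factors polynomial in the length to be harmless.\<close>

lemma walk_weight_sum_le:
  fixes \<epsilon> :: real
  assumes "\<epsilon> > 0"
  shows "\<exists>C::real. C \<ge> 1 \<and> (\<forall>s V L. V \<subseteq> char_vectors s c \<longrightarrow> real (card V) \<le> 2 ^ s / (1 + \<epsilon>) \<longrightarrow>
    2 ^ s \<le> (1 + \<epsilon>) ^ L \<longrightarrow> (\<forall>p<L. (1 + \<epsilon>) ^ p < 2 ^ s) \<longrightarrow>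
    (\<Sum>(k, z)\<in>walk_witnesses c s V L. (1 / 2 ^ s) ^ k) \<le> C * card V / 2 ^ s)"
proof -
  define \<theta> where "\<theta> = 1 / (1 + \<epsilon>)"
  \<comment> \<open>Walks that end in a dependent step decay like \<open>\<eta> ^ p\<close>, which
    is \<open>\<sigma> ^ p\<close> twice: one copy absorbs the polynomial factors, the other is
    summed as a geometric series.\<close>
  define \<eta> where "\<eta> = sqrt \<theta>"
  define \<sigma> where "\<sigma> = sqrt \<eta>"
  have \<theta>: "0 < \<theta>" "\<theta> < 1" using assms by (auto simp: \<theta>_def)
  then have \<eta>: "0 < \<eta>" "\<eta> < 1" by (auto simp: \<eta>_def)
  then have \<sigma>: "0 < \<sigma>" "\<sigma> < 1" by (auto simp: \<sigma>_def)
  obtain K1 where K1: "K1 > 0" "\<And>p. (real p + 2) ^ (c + 1) \<le> K1 * (1 + \<epsilon>) ^ p"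
    using power_le_exponential[of "1 + \<epsilon>" "c + 1"] assms by auto
  obtain K2 where K2: "K2 > 0" "\<And>p. (real p + 2) ^ (2 * c + 1) \<le> K2 * (1 / \<sigma>) ^ p"
    using power_le_exponential[of "1 / \<sigma>" "2 * c + 1"] \<sigma> by auto
  \<comment> \<open>The 1 accounts for walks that stay free for \<open>L\<close> steps, the rest for
    walks with a dependent step.\<close>
  define C where "C = 1 + K2 * exp K1 / (1 - \<sigma>)"
  have "C \<ge> 1" using K2(1) \<sigma> by (simp add: C_def)
  moreover have "(\<Sum>(k, z)\<in>walk_witnesses c s V L. (1 / 2 ^ s) ^ k) \<le> C * card V / 2 ^ s"
    if V: "V \<subseteq> char_vectors s c" and cV: "real (card V) \<le> 2 ^ s / (1 + \<epsilon>)"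
      and L: "2 ^ s \<le> (1 + \<epsilon>) ^ L" "\<And>p. p < L \<Longrightarrow> (1 + \<epsilon>) ^ p < 2 ^ s" for s V L
  proof -
    define m :: real where "m = 2 ^ s"
    define n where "n = real (card V)"
    have m: "m > 0" by (simp add: m_def)
    have n: "n \<ge> 0" by (simp add: n_def)
    have \<rho>: "n / m \<le> \<theta>"
      using cV m by (simp add: n_def m_def \<theta>_def field_simps)
    have finV: "finite V" using V finite_subset finite_char_vectors by blast
    define A where "A = {z \<in> {..L} \<rightarrow>\<^sub>E V. free_walk c s z L}"
    define D where "D p = {z \<in> {..Suc p} \<rightarrow>\<^sub>E V. free_walk c s z p \<and> step_dep c s z p \<and> z p \<noteq> z (Suc p)}" for p
    have fin: "finite A" "finite (D p)" for p
      unfolding A_def D_def using finV by (auto intro!: finite_Collect_conjI disjI1 simp: finite_PiE)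
    have "real (card A) \<le> n ^ (L + 1)"
    proof -
      have "card A \<le> card ({..L} \<rightarrow>\<^sub>E V)"
        unfolding A_def using finV by (intro card_mono) (auto simp: finite_PiE)
      then have "card A \<le> card V ^ (L + 1)" by (simp add: card_PiE)
      then show ?thesis unfolding n_def by (metis of_nat_le_iff of_nat_power)
    qed
    then have "real (card A) * (1 / m) ^ L \<le> n ^ (L + 1) * (1 / m) ^ L"
      using m by (intro mult_right_mono) auto
    also have "\<dots> = n * (n / m) ^ L"
      by (simp add: power_divide)
    also have "\<dots> \<le> n * \<theta> ^ L"
      using n m \<rho> by (intro mult_left_mono power_mono) auto
    \<comment> \<open>By the choice of \<open>L\<close>, \<open>\<theta> ^ L\<close> is at most
      \<open>1 / m\<close>.\<close>
    also have "\<dots> \<le> n * (1 / m)"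
      using n L(1) m assms by (intro mult_left_mono) (simp_all add: \<theta>_def m_def power_divide field_simps)
    finally have A: "real (card A) * (1 / m) ^ L \<le> n / m" by simp
    have D: "real (card (D p)) * (1 / m) ^ p \<le> n / m * (K2 * exp K1) * \<sigma> ^ p" if p: "p < L" for p
    proof -
      define I where "I = {q. q < p \<and> q mod 2 = p mod 2}"
      define B where "B = (real p + 2) ^ c"
      have B: "B \<ge> 0" by (simp add: B_def)
      have I: "finite I" "card I \<le> p"
        using card_same_parity_le[of I p] by (auto simp: I_def)
      have "card (D p) \<le> card {z \<in> {..Suc p} \<rightarrow>\<^sub>E V. step_dep c s z p \<and> z p \<noteq> z (Suc p)}"
        unfolding D_def using finV
        by (intro card_mono finite_Collect_conjI disjI1) (auto simp: finite_PiE)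
      also have "\<dots> \<le> (\<Sum>J\<in>Pow I - {{}}.
          (p + 2) ^ (c * (card J + 1)) * card V ^ (card J + 1) * card V ^ (p - 2 * card J))"
        unfolding I_def by (rule card_dep_walks_le[OF V])
      finally have "real (card (D p)) \<le> real (\<Sum>J\<in>Pow I - {{}}.
          (p + 2) ^ (c * (card J + 1)) * card V ^ (card J + 1) * card V ^ (p - 2 * card J))"
        by (rule of_nat_mono)
      also have "\<dots> = (\<Sum>J\<in>Pow I - {{}}. B ^ (card J + 1) * n ^ (card J + 1) * n ^ (p - 2 * card J))"
        by (simp only: B_def n_def of_nat_sum of_nat_mult of_nat_power of_nat_add of_nat_numeral power_mult)
      finally have "real (card (D p)) * (1 / m) ^ p \<le>
          (\<Sum>J\<in>Pow I - {{}}. B ^ (card J + 1) * n ^ (card J + 1) * n ^ (p - 2 * card J)) * (1 / m) ^ p"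
        using m by (intro mult_right_mono) auto
      also have "\<dots> = (\<Sum>J\<in>Pow I - {{}}. B ^ (card J + 1) * n ^ (card J + 1) * n ^ (p - 2 * card J) * (1 / m) ^ p)"
        by (rule sum_distrib_right)
      also have "\<dots> \<le> (\<Sum>J\<in>Pow I - {{}}. n / m * B\<^sup>2 * \<eta> ^ p * (B / m) ^ (card J - 1))"
      proof (rule sum_mono)
        fix J assume J: "J \<in> Pow I - {{}}"
        then have "finite J" using I finite_subset by blast
        then have "card J \<ge> 1" using J by (simp add: Suc_le_eq card_gt_0_iff)
        moreover have "2 * card J \<le> p" using J by (intro card_same_parity_le) (auto simp: I_def)
        ultimately show "B ^ (card J + 1) * n ^ (card J + 1) * n ^ (p - 2 * card J) * (1 / m) ^ p \<le>
            n / m * B\<^sup>2 * \<eta> ^ p * (B / m) ^ (card J - 1)"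
          unfolding \<eta>_def using m n \<rho> \<theta> B by (intro dep_walk_term_le) auto
      qed
      also have "\<dots> = n / m * B\<^sup>2 * \<eta> ^ p * (\<Sum>J\<in>Pow I - {{}}. (B / m) ^ (card J - 1))"
        by (simp add: sum_distrib_left)
      also have "\<dots> \<le> n / m * B\<^sup>2 * \<eta> ^ p * (real p * exp K1)"
      proof (rule mult_left_mono)
        \<comment> \<open>Summing over all dependencies costs only a factor linear in
          \<open>p\<close>, because \<open>card I * (B / m)\<close> stays bounded for
          \<open>p < L\<close>.\<close>
        have "(\<Sum>J\<in>Pow I - {{}}. (B / m) ^ (card J - 1)) \<le> card I * (1 + B / m) ^ card I"
          using I B m by (intro sum_nonempty_Pow_power_card_le) auto
        also have "\<dots> \<le> real p * exp K1"
        proof (rule mult_mono)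
          have "(1 + B / m) ^ card I \<le> exp (B / m) ^ card I"
            using B m by (intro power_mono) (auto simp: exp_ge_add_one_self)
          also have "\<dots> = exp (card I * (B / m))"
            by (rule exp_of_nat_mult[symmetric])
          also have "\<dots> \<le> exp K1"
          proof (subst exp_le_cancel_iff)
            have "card I * (B / m) \<le> (real p + 2) * (B / m)"
              using I(2) B m by (intro mult_right_mono) auto
            also have "\<dots> = (real p + 2) ^ (c + 1) / m" by (simp add: B_def)
            also have "\<dots> \<le> K1 * (1 + \<epsilon>) ^ p / m"
              using K1(2) m by (intro divide_right_mono) auto
            \<comment> \<open>Here the walk must not be too long: \<open>p < L\<close> means
              \<open>(1 + \<epsilon>) ^ p < m\<close>.\<close>
            also have "\<dots> \<le> K1 * m / m"
              using L(2)[OF p] K1(1) m by (intro divide_right_mono mult_left_mono) (auto simp: m_def)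
            finally show "card I * (B / m) \<le> K1" using m by simp
          qed
          finally show "(1 + B / m) ^ card I \<le> exp K1" .
        qed (use I B m in auto)
        finally show "(\<Sum>J\<in>Pow I - {{}}. (B / m) ^ (card J - 1)) \<le> real p * exp K1" .
      qed (use n m \<eta> in auto)
      also have "\<dots> = n / m * exp K1 * \<eta> ^ p * (real p * B\<^sup>2)" by simp
      also have "\<dots> \<le> n / m * exp K1 * \<eta> ^ p * (K2 * (1 / \<sigma>) ^ p)"
      proof (rule mult_left_mono)
        have "real p * B\<^sup>2 \<le> (real p + 2) * B\<^sup>2" by (intro mult_right_mono) auto
        also have "\<dots> = (real p + 2) ^ (2 * c + 1)"
          by (simp add: B_def power_mult[symmetric] mult.commute)
        finally show "real p * B\<^sup>2 \<le> K2 * (1 / \<sigma>) ^ p" using K2(2)[of p] by linarith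
      qed (use n m \<eta> in auto)
      also have "\<dots> = n / m * (K2 * exp K1) * (\<eta> * (1 / \<sigma>)) ^ p"
        by (simp only: power_mult_distrib mult_ac)
      also have "\<eta> * (1 / \<sigma>) = \<sigma>"
        using \<sigma> \<eta> by (simp add: \<sigma>_def real_div_sqrt)
      finally show ?thesis .
    qed
    have "(\<Sum>(k, z)\<in>walk_witnesses c s V L. (1 / m) ^ k) =
        (\<Sum>(k, z)\<in>{L} \<times> A. (1 / m) ^ k) + (\<Sum>(k, z)\<in>(SIGMA p:{..<L}. D p). (1 / m) ^ k)"
      unfolding walk_witnesses_def A_def[symmetric] D_def[symmetric]
      using fin by (intro sum.union_disjoint) auto
    also have "(\<Sum>(k, z)\<in>{L} \<times> A. (1 / m) ^ k) = real (card A) * (1 / m) ^ L"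
      by (simp add: sum.cartesian_product[symmetric])
    also have "(\<Sum>(k, z)\<in>(SIGMA p:{..<L}. D p). (1 / m) ^ k) = (\<Sum>p<L. real (card (D p)) * (1 / m) ^ p)"
      using fin by (subst sum.Sigma[symmetric]) auto
    also have "real (card A) * (1 / m) ^ L + (\<Sum>p<L. real (card (D p)) * (1 / m) ^ p) \<le>
        n / m + (\<Sum>p<L. n / m * (K2 * exp K1) * \<sigma> ^ p)"
      by (intro add_mono A sum_mono D) auto
    also have "(\<Sum>p<L. n / m * (K2 * exp K1) * \<sigma> ^ p) = n / m * (K2 * exp K1) * (\<Sum>p<L. \<sigma> ^ p)"
      by (rule sum_distrib_left[symmetric])
    also have "n / m + \<dots> \<le> n / m + n / m * (K2 * exp K1) * (1 / (1 - \<sigma>))"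
    proof (intro add_left_mono mult_left_mono)
      have "(\<Sum>p<L. \<sigma> ^ p) = (1 - \<sigma> ^ L) / (1 - \<sigma>)"
        using \<sigma> by (simp add: sum_gp_strict)
      also have "\<dots> \<le> 1 / (1 - \<sigma>)"
        using \<sigma> by (intro divide_right_mono) auto
      finally show "(\<Sum>p<L. \<sigma> ^ p) \<le> 1 / (1 - \<sigma>)" .
    qed (use n m K2 in auto)
    also have "\<dots> = C * card V / 2 ^ s"
      unfolding C_def n_def m_def by (simp add: algebra_simps add_divide_distrib)
    finally show ?thesis unfolding m_def .
  qed
  ultimately show ?thesis by (intro exI[of _ C]) simp
qed

section \<open>Cores\<close>

definition core :: "nat \<Rightarrow> (nat \<times> nat \<Rightarrow> nat list) \<Rightarrow> nat list set \<Rightarrow> bool" where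
  "core d T Y \<longleftrightarrow> Y \<noteq> {} \<and>
     (\<forall>v\<in>Y. \<forall>j<d. \<exists>v'\<in>Y. v' \<noteq> v \<and> derived_char T j v = derived_char T j v')"

text \<open>A core containing \<open>x\<close> yields one witness from \<open>x\<close> for each of
  the \<open>d div 2\<close> pairs. The equations of different pairs are independent, so a union
  bound over tuples of witnesses factorizes into a power of the sum for one pair.\<close>

lemma card_core_containing_le:
  assumes "V \<subseteq> char_vectors s c"
  shows "real (card {T \<in> tables c s (char_vectors s d). \<exists>Y\<subseteq>V. x \<in> Y \<and> core d T Y}) \<le>
    card (tables c s (char_vectors s d)) *
    (\<Sum>(n, z)\<in>{(n, z) \<in> walk_witnesses c s V L. z 0 = x}. (1 / 2 ^ s) ^ n) ^ (d div 2)"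
proof -
  define \<Omega> where "\<Omega> = tables c s (char_vectors s d)"
  define W where "W = {(n, z) \<in> walk_witnesses c s V L. z 0 = x}"
  define K where "K = d div 2"
  define es where "es w = concat (map (\<lambda>k. walk_eqs k (snd (w k)) (fst (w k))) [0..<K])"
    for w :: "nat \<Rightarrow> nat \<times> (nat \<Rightarrow> nat list)"
  have fin\<Omega>: "finite \<Omega>" by (simp add: \<Omega>_def)
  have finV: "finite V" using assms finite_subset finite_char_vectors by blast
  have finW: "finite W"
    unfolding W_def by (rule finite_subset[OF _ finite_walk_witnesses[OF finV]]) auto
  have "{T \<in> \<Omega>. \<exists>Y\<subseteq>V. x \<in> Y \<and> core d T Y} \<subseteq>
      (\<Union>w\<in>{..<K} \<rightarrow>\<^sub>E W. {T \<in> \<Omega>. eqs_hold T (set (es w))})"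
  proof
    fix T assume "T \<in> {T \<in> \<Omega>. \<exists>Y\<subseteq>V. x \<in> Y \<and> core d T Y}"
    then obtain Y where T: "T \<in> \<Omega>" and Y: "Y \<subseteq> V" "x \<in> Y" "core d T Y" by blast
    have "\<exists>w\<in>W. \<forall>p<fst w. derived_char T (2 * k + p mod 2) (snd w p) =
        derived_char T (2 * k + p mod 2) (snd w (Suc p))" if k: "k < K" for k
    proof -
      have "2 * k + b < d" if "b < 2" for b
        using k that unfolding K_def by linarith
      then have "\<exists>v'\<in>Y. v' \<noteq> v \<and> derived_char T (2 * k + b) v = derived_char T (2 * k + b) v'"
        if "v \<in> Y" "b < 2" for v b
        using Y(3) that unfolding core_def by blast
      from walk_witness_exists[of x Y "\<lambda>b. derived_char T (2 * k + b)" c s L, OF Y(2) this]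
      obtain n z where "(n, z) \<in> walk_witnesses c s Y L" "z 0 = x" "\<forall>p<n.
          derived_char T (2 * k + p mod 2) (z p) = derived_char T (2 * k + p mod 2) (z (Suc p))"
        by blast
      moreover from this have "(n, z) \<in> W"
        using walk_witnesses_mono[OF Y(1)] unfolding W_def by blast
      ultimately show ?thesis by (intro bexI[of _ "(n, z)"]) auto
    qed
    then obtain w where w: "\<And>k. k < K \<Longrightarrow> w k \<in> W \<and> (\<forall>p<fst (w k).
        derived_char T (2 * k + p mod 2) (snd (w k) p) =
        derived_char T (2 * k + p mod 2) (snd (w k) (Suc p)))"
      by metis
    \<comment> \<open>The restriction makes the choice of witnesses an element of the finite
      extensional product.\<close>
    define w' where "w' = restrict w {..<K}"
    have "w' \<in> {..<K} \<rightarrow>\<^sub>E W" using w by (auto simp: w'_def)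
    moreover have "eqs_hold T (set (es w'))"
      using w by (auto simp: eqs_hold_def es_def walk_eqs_def w'_def)
    ultimately show "T \<in> (\<Union>w\<in>{..<K} \<rightarrow>\<^sub>E W. {T \<in> \<Omega>. eqs_hold T (set (es w))})"
      using T by blast
  qed
  then have "card {T \<in> \<Omega>. \<exists>Y\<subseteq>V. x \<in> Y \<and> core d T Y} \<le>
      card (\<Union>w\<in>{..<K} \<rightarrow>\<^sub>E W. {T \<in> \<Omega>. eqs_hold T (set (es w))})"
    using fin\<Omega> finW by (intro card_mono finite_UN_I) (auto intro!: finite_PiE)
  also have "\<dots> \<le> (\<Sum>w\<in>{..<K} \<rightarrow>\<^sub>E W. card {T \<in> \<Omega>. eqs_hold T (set (es w))})"
    using finW by (intro card_UN_le) (auto intro!: finite_PiE)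
  finally have "real (card {T \<in> \<Omega>. \<exists>Y\<subseteq>V. x \<in> Y \<and> core d T Y}) \<le>
      (\<Sum>w\<in>{..<K} \<rightarrow>\<^sub>E W. real (card {T \<in> \<Omega>. eqs_hold T (set (es w))}))"
    by (simp flip: of_nat_sum)
  also have "\<dots> \<le> (\<Sum>w\<in>{..<K} \<rightarrow>\<^sub>E W. card \<Omega> * (\<Prod>k<K. (1 / 2 ^ s) ^ fst (w k)))"
  proof (rule sum_mono)
    fix w assume w: "w \<in> {..<K} \<rightarrow>\<^sub>E W"
    have wk: "free_walk c s (snd (w k)) (fst (w k))"
        "\<And>i. i \<le> fst (w k) \<Longrightarrow> snd (w k) i \<in> char_vectors s c" if "k < K" for k
    proof -
      have "w k \<in> W" using w that by auto
      then have "(fst (w k), snd (w k)) \<in> walk_witnesses c s V L" by (auto simp: W_def)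
      from walk_witnessesD[OF this] assms show "free_walk c s (snd (w k)) (fst (w k))"
        "\<And>i. i \<le> fst (w k) \<Longrightarrow> snd (w k) i \<in> char_vectors s c" by auto
    qed
    have "indep_eqs (es w)"
      unfolding es_def
    proof (rule indep_eqs_concat)
      fix k assume "k < K"
      then show "indep_eqs (walk_eqs k (snd (w k)) (fst (w k)))"
        by (intro indep_walk_eqs[of c s] wk)
    next
      fix k l :: nat assume "k \<noteq> l"
      then have "2 * k + p mod 2 \<noteq> 2 * l + q mod 2" for p q :: nat by presburger
      then show "fst ` set (walk_eqs k (snd (w k)) (fst (w k))) \<inter>
          fst ` set (walk_eqs l (snd (w l)) (fst (w l))) = {}"
        by (auto simp: walk_eqs_def)
    qed
    moreover have "\<forall>(j, x, y)\<in>set (es w). j < d \<and> x \<in> char_vectors s c \<and> y \<in> char_vectors s c"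
    proof -
      have "2 * k + p mod 2 < d" if "k < K" for k p
        using that unfolding K_def by linarith
      then show ?thesis using wk(2) by (auto simp: es_def walk_eqs_def)
    qed
    ultimately have "card {T \<in> \<Omega>. eqs_hold T (set (es w))} * 2 ^ (s * length (es w)) \<le> card \<Omega>"
      unfolding \<Omega>_def by (rule card_indep_eqs_le)
    from of_nat_mono[OF this, where 'a = real]
    have "real (card {T \<in> \<Omega>. eqs_hold T (set (es w))}) * 2 ^ (s * length (es w)) \<le> card \<Omega>"
      by simp
    moreover have "length (es w) = (\<Sum>k<K. fst (w k))"
      by (simp add: es_def walk_eqs_def length_concat comp_def interv_sum_list_conv_sum_set_nat atLeast0LessThan)
    then have "(2::real) ^ (s * length (es w)) = (\<Prod>k<K. (2 ^ s) ^ fst (w k))"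
      by (simp add: power_mult power_sum)
    moreover have "(\<Prod>k<K. (1 / 2 ^ s) ^ fst (w k)) = 1 / (\<Prod>k<K. (2 ^ s) ^ fst (w k) :: real)"
      by (simp add: power_divide prod_dividef)
    moreover have "(\<Prod>k<K. (2 ^ s) ^ fst (w k) :: real) > 0"
      by (intro prod_pos) simp
    ultimately show "real (card {T \<in> \<Omega>. eqs_hold T (set (es w))}) \<le>
        card \<Omega> * (\<Prod>k<K. (1 / 2 ^ s) ^ fst (w k))"
      by (simp only: times_divide_eq_right mult_1_right pos_le_divide_eq)
  qed
  \<comment> \<open>Distributivity: the sum over tuples of products is the product of the
    sums.\<close>
  also have "\<dots> = card \<Omega> * (\<Prod>k<K. \<Sum>w\<in>W. (1 / 2 ^ s) ^ fst w)"
    using finW by (subst prod_sum_PiE) (auto simp: sum_distrib_left)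
  also have "\<dots> = card \<Omega> * (\<Sum>(n, z)\<in>W. (1 / 2 ^ s) ^ n) ^ K"
    by (simp add: case_prod_unfold)
  finally show ?thesis unfolding \<Omega>_def W_def K_def .
qed

text \<open>Averaging finds a key \<open>x\<close> of \<open>V\<close> whose witnesses have weight
  at most \<open>C / 2 ^ s\<close>; the induction removes it. This is why the weight bound is
  assumed for all subsets of \<open>U\<close>.\<close>

lemma card_core_le:
  fixes C :: real
  assumes bound: "\<And>V. V \<subseteq> U \<Longrightarrow>
      (\<Sum>(n, z)\<in>walk_witnesses c s V L. (1 / 2 ^ s) ^ n) \<le> C * card V / 2 ^ s"
    and "V \<subseteq> U" "U \<subseteq> char_vectors s c"
  shows "real (card {T \<in> tables c s (char_vectors s d). \<exists>Y\<subseteq>V. core d T Y}) \<le>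
    card V * (C / 2 ^ s) ^ (d div 2) * card (tables c s (char_vectors s d))"
  using assms(2)
proof (induction "card V" arbitrary: V)
  case 0
  have "finite V" using 0 assms(3) finite_subset finite_char_vectors by (metis subset_trans)
  then have "V = {}" using 0 by simp
  then show ?case by (auto simp: core_def)
next
  case (Suc n)
  define \<Omega> where "\<Omega> = tables c s (char_vectors s d)"
  define q where "q x = (\<Sum>(n, z)\<in>{(n, z) \<in> walk_witnesses c s V L. z 0 = x}. (1 / 2 ^ s :: real) ^ n)" for x
  have fin\<Omega>: "finite \<Omega>" by (simp add: \<Omega>_def)
  have finV: "finite V" using Suc.hyps(2) by (metis card.infinite nat.simps(3))
  have "(\<Sum>x\<in>V. q x) = (\<Sum>x\<in>V. \<Sum>w\<in>{w \<in> walk_witnesses c s V L. snd w 0 = x}. (1 / 2 ^ s) ^ fst w)"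
    unfolding q_def by (intro sum.cong refl) (auto simp: case_prod_unfold)
  \<comment> \<open>Each witness is counted once, at its starting key.\<close>
  also have "\<dots> = (\<Sum>w\<in>walk_witnesses c s V L. (1 / 2 ^ s) ^ fst w)"
    using finV finite_walk_witnesses[OF finV] walk_witnessesD(2)[of _ _ c s V L 0]
    by (intro sum.group) auto
  also have "\<dots> \<le> C * card V / 2 ^ s"
    using bound[OF Suc.prems] by (simp add: case_prod_unfold)
  finally have sum_q: "(\<Sum>x\<in>V. q x) \<le> C * card V / 2 ^ s" .
  have "\<exists>x\<in>V. q x \<le> C / 2 ^ s"
  proof (rule ccontr)
    assume "\<not> ?thesis"
    then have "(\<Sum>x\<in>V. C / 2 ^ s) < (\<Sum>x\<in>V. q x)"
      using finV Suc.hyps(2) by (intro sum_strict_mono) auto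
    then show False using sum_q by (simp add: mult.commute)
  qed
  then obtain x where x: "x \<in> V" "q x \<le> C / 2 ^ s" by blast
  have "q x \<ge> 0" unfolding q_def by (intro sum_nonneg) auto
  have "real (card {T \<in> \<Omega>. \<exists>Y\<subseteq>V. x \<in> Y \<and> core d T Y}) \<le> card \<Omega> * q x ^ (d div 2)"
    unfolding \<Omega>_def q_def using Suc.prems assms(3) by (intro card_core_containing_le) auto
  also have "\<dots> \<le> card \<Omega> * (C / 2 ^ s) ^ (d div 2)"
    using x(2) \<open>q x \<ge> 0\<close> by (intro mult_left_mono power_mono) auto
  finally have *: "real (card {T \<in> \<Omega>. \<exists>Y\<subseteq>V. x \<in> Y \<and> core d T Y}) \<le> card \<Omega> * (C / 2 ^ s) ^ (d div 2)" .
  have n: "card (V - {x}) = n" using x(1) Suc.hyps(2) finV by simp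
  have **: "real (card {T \<in> \<Omega>. \<exists>Y\<subseteq>V - {x}. core d T Y}) \<le> n * (C / 2 ^ s) ^ (d div 2) * card \<Omega>"
    using Suc.hyps(1)[of "V - {x}"] Suc.prems n unfolding \<Omega>_def by auto
  \<comment> \<open>A core either contains \<open>x\<close> or lies in
    \<open>V - {x}\<close>.\<close>
  have "{T \<in> \<Omega>. \<exists>Y\<subseteq>V. core d T Y} \<subseteq>
      {T \<in> \<Omega>. \<exists>Y\<subseteq>V. x \<in> Y \<and> core d T Y} \<union> {T \<in> \<Omega>. \<exists>Y\<subseteq>V - {x}. core d T Y}"
    by blast
  then have "card {T \<in> \<Omega>. \<exists>Y\<subseteq>V. core d T Y} \<le>
      card ({T \<in> \<Omega>. \<exists>Y\<subseteq>V. x \<in> Y \<and> core d T Y} \<union> {T \<in> \<Omega>. \<exists>Y\<subseteq>V - {x}. core d T Y})"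
    using fin\<Omega> by (intro card_mono) auto
  also have "\<dots> \<le> card {T \<in> \<Omega>. \<exists>Y\<subseteq>V. x \<in> Y \<and> core d T Y} + card {T \<in> \<Omega>. \<exists>Y\<subseteq>V - {x}. core d T Y}"
    by (rule card_Un_le)
  finally have "real (card {T \<in> \<Omega>. \<exists>Y\<subseteq>V. core d T Y}) \<le>
      card \<Omega> * (C / 2 ^ s) ^ (d div 2) + n * (C / 2 ^ s) ^ (d div 2) * card \<Omega>"
    using * ** by linarith
  also have "\<dots> = real (Suc n) * (C / 2 ^ s) ^ (d div 2) * card \<Omega>"
    by (simp add: algebra_simps)
  finally show ?case unfolding \<Omega>_def using Suc.hyps(2) by simp
qed

section \<open>Peeling\<close>

text \<open>An event about finitely many of the variables is the preimage of a box under the whole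
  tuple, and a product distribution is multiplicative on boxes.\<close>

lemma indep_vars_of_joint_Pi_pmf:
  assumes "finite X"
    and joint: "map_pmf (\<lambda>T x. if x \<in> X then f x T else undefined) M = Pi_pmf X undefined p"
  shows "prob_space.indep_vars (measure_pmf M) (\<lambda>_. count_space UNIV) f X"
    and "x \<in> X \<Longrightarrow> map_pmf (f x) M = p x"
proof -
  let ?F = "\<lambda>T x. if x \<in> X then f x T else undefined"
  show marginal: "map_pmf (f x) M = p x" if "x \<in> X" for x
  proof -
    have "map_pmf (f x) M = map_pmf (\<lambda>g. g x) (map_pmf ?F M)"
      using that by (simp add: pmf.map_comp o_def)
    also have "\<dots> = p x"
      unfolding joint using that assms(1) by (simp add: Pi_pmf_component)
    finally show ?thesis .
  qed
  show "prob_space.indep_vars (measure_pmf M) (\<lambda>_. count_space UNIV) f X"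
    unfolding prob_space.indep_vars_def2[OF measure_pmf.prob_space_axioms]
  proof (intro conjI ballI prob_space.indep_setsI[OF measure_pmf.prob_space_axioms])
    fix A J assume J: "J \<noteq> {}" "J \<subseteq> X" "finite J"
      and "\<forall>j\<in>J. A j \<in> {f j -` B \<inter> space (measure_pmf M) | B. B \<in> sets (count_space UNIV)}"
    then have "\<forall>j\<in>J. \<exists>B. A j = f j -` B" by auto
    then obtain B where B: "\<And>j. j \<in> J \<Longrightarrow> A j = f j -` B j" by metis
    \<comment> \<open>Coordinates outside \<open>J\<close> are unconstrained and contribute factors
      1.\<close>
    let ?B = "\<lambda>x. if x \<in> J then B x else UNIV"
    have "measure_pmf.prob M (\<Inter>j\<in>J. A j) = measure_pmf.prob M (?F -` Pi X ?B)"
      using B J(2) by (intro arg_cong[of _ _ "measure_pmf.prob M"]) (fastforce simp: Pi_iff subset_iff)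
    also have "\<dots> = measure_pmf.prob (Pi_pmf X undefined p) (Pi X ?B)"
      by (simp flip: joint)
    also have "\<dots> = (\<Prod>x\<in>X. measure_pmf.prob (p x) (?B x))"
      using assms(1) by (rule measure_Pi_pmf_Pi)
    also have "\<dots> = (\<Prod>x\<in>J. measure_pmf.prob (p x) (?B x))"
      using J assms(1) by (intro prod.mono_neutral_right) auto
    also have "\<dots> = (\<Prod>j\<in>J. measure_pmf.prob M (A j))"
    proof (intro prod.cong refl)
      fix j assume j: "j \<in> J"
      then have "p j = map_pmf (f j) M"
        using marginal J(2) by auto
      then show "measure_pmf.prob (p j) (?B j) = measure_pmf.prob M (A j)"
        using B[OF j] j by simp
    qed
    finally show "measure_pmf.prob M (\<Inter>j\<in>J. A j) = (\<Prod>j\<in>J. measure_pmf.prob M (A j))" .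
  qed auto
qed

text \<open>If some key \<open>x\<close> is the only one to use a certain table entry, then conditionally on all other
  entries its hash value is uniform, and independent of the other hash values; so \<open>x\<close> can be
  peeled off.\<close>

lemma card_tables_peelable:
  fixes D :: "'k \<Rightarrow> nat list"
  assumes "finite Y" "\<And>x. x \<in> Y \<Longrightarrow> D x \<in> char_vectors s N"
    and peel: "\<And>Z. Z \<subseteq> Y \<Longrightarrow> Z \<noteq> {} \<Longrightarrow> \<exists>x\<in>Z. \<exists>i<N. \<forall>y\<in>Z. y \<noteq> x \<longrightarrow> D y ! i \<noteq> D x ! i"
    and "\<And>x. x \<in> Y \<Longrightarrow> \<rho> x \<in> bit_strings r"
  shows "card {T \<in> tables N s (bit_strings r). \<forall>x\<in>Y. simple_tab xor 0 T (D x) = \<rho> x} * 2 ^ (r * card Y) =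
    card (tables N s (bit_strings r))"
  using assms
proof (induction Y rule: finite_psubset_induct)
  case (psubset Y)
  define \<Omega> where "\<Omega> = tables N s (bit_strings r)"
  define S where "S Z = {T \<in> \<Omega>. \<forall>x\<in>Z. simple_tab xor 0 T (D x) = \<rho> x}" for Z
  show ?case
  proof (cases "Y = {}")
    case False
    then obtain x i where x: "x \<in> Y" "i < N" "\<And>y. y \<in> Y \<Longrightarrow> y \<noteq> x \<Longrightarrow> D y ! i \<noteq> D x ! i"
      using psubset.prems(2)[of Y] by blast
    \<comment> \<open>Selects the single entry that \<open>x\<close> reads at position
      \<open>i\<close> and no other key of \<open>Y\<close> does.\<close>
    define W where "W e = (of_bool (e = (i, D x ! i)) :: bit)" for e
    define sh where "sh a T e = T e XOR (if W e = 1 then a else 0)" for a :: nat and T e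
    have entry: "entry_sum W (D y) = of_bool (y = x)" if y: "y \<in> Y" for y
    proof -
      have len: "length (D y) = N" using psubset.prems(1)[OF y] by (simp add: char_vectors_def)
      have "entry_sum W (D y) = (\<Sum>k<N. if k = i then of_bool (D y ! i = D x ! i) else 0)"
        unfolding entry_sum_def len W_def by (intro sum.cong) auto
      also have "\<dots> = of_bool (D y ! i = D x ! i)" using x(2) by simp
      also have "\<dots> = of_bool (y = x)" using x(3)[OF y] by auto
      finally show ?thesis .
    qed
    have tab: "simple_tab xor 0 (sh a T) (D y) = simple_tab xor 0 T (D y) XOR (if y = x then a else 0)"
      if "y \<in> Y" for y a T
      unfolding sh_def simple_tab_xor_shift entry[OF that] by auto
    have dom: "(i, D x ! i) \<in> {..<N} \<times> bit_strings s"
      using psubset.prems(1)[OF x(1)] x(2) by (auto simp: char_vectors_def)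
    have sh_\<Omega>: "sh a T \<in> \<Omega>" if "T \<in> \<Omega>" "a \<in> bit_strings r" for a T
      using that dom by (auto simp: \<Omega>_def tables_def PiE_dflt_def sh_def W_def intro!: xor_in_bit_strings)
    have sh_sh: "sh a (sh a T) = T" for a T
      by (auto simp: sh_def xor.assoc)
    have f_bits: "simple_tab xor 0 T (D x) \<in> bit_strings r" if "T \<in> \<Omega>" for T
    proof (rule simple_tab_xor_in_bit_strings)
      fix k assume "k < length (D x)"
      then show "T (k, D x ! k) \<in> bit_strings r"
        using char_vectors_entry[OF psubset.prems(1)[OF x(1)]] that tablesD unfolding \<Omega>_def by blast
    qed
    \<comment> \<open>Shifting this entry changes the hash value of \<open>x\<close> alone. A table
      that is correct on \<open>Y - {x}\<close> therefore becomes correct on \<open>Y\<close> by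
      exactly one shift, the difference between actual and desired value.\<close>
    have "bij_betw (\<lambda>(T, a). sh a T) (S Y \<times> bit_strings r) (S (Y - {x}))"
    proof (rule bij_betw_byWitness[where f' = "\<lambda>T. (sh (simple_tab xor 0 T (D x) XOR \<rho> x) T,
        simple_tab xor 0 T (D x) XOR \<rho> x)"])
      show "\<forall>p\<in>S Y \<times> bit_strings r. (\<lambda>T. (sh (simple_tab xor 0 T (D x) XOR \<rho> x) T,
          simple_tab xor 0 T (D x) XOR \<rho> x)) ((\<lambda>(T, a). sh a T) p) = p"
      proof (rule ballI)
        fix p assume "p \<in> S Y \<times> bit_strings r"
        then obtain T a where p: "p = (T, a)" "T \<in> S Y" by blast
        then have "simple_tab xor 0 (sh a T) (D x) XOR \<rho> x = a"
          using x(1) by (simp add: tab S_def ac_simps flip: xor.assoc)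
        then show "(\<lambda>T. (sh (simple_tab xor 0 T (D x) XOR \<rho> x) T,
            simple_tab xor 0 T (D x) XOR \<rho> x)) ((\<lambda>(T, a). sh a T) p) = p"
          by (simp add: p(1) sh_sh)
      qed
      show "\<forall>T\<in>S (Y - {x}). (\<lambda>(T, a). sh a T) (sh (simple_tab xor 0 T (D x) XOR \<rho> x) T,
          simple_tab xor 0 T (D x) XOR \<rho> x) = T"
        by (simp add: sh_sh)
      show "(\<lambda>(T, a). sh a T) ` (S Y \<times> bit_strings r) \<subseteq> S (Y - {x})"
        by (auto simp: S_def tab sh_\<Omega> split: if_splits)
      show "(\<lambda>T. (sh (simple_tab xor 0 T (D x) XOR \<rho> x) T, simple_tab xor 0 T (D x) XOR \<rho> x)) ` S (Y - {x})
          \<subseteq> S Y \<times> bit_strings r"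
      proof (rule image_subsetI)
        fix T assume "T \<in> S (Y - {x})"
        then have T: "T \<in> \<Omega>" "\<And>y. y \<in> Y \<Longrightarrow> y \<noteq> x \<Longrightarrow> simple_tab xor 0 T (D y) = \<rho> y"
          by (auto simp: S_def)
        let ?a = "simple_tab xor 0 T (D x) XOR \<rho> x"
        have a: "?a \<in> bit_strings r"
          using f_bits[OF T(1)] psubset.prems(3)[OF x(1)] by (rule xor_in_bit_strings)
        moreover have "simple_tab xor 0 (sh ?a T) (D y) = \<rho> y" if "y \<in> Y" for y
          using that T(2) by (cases "y = x") (simp_all add: tab flip: xor.assoc)
        ultimately show "(sh ?a T, ?a) \<in> S Y \<times> bit_strings r"
          using sh_\<Omega>[OF T(1) a] by (auto simp: S_def)
      qed
    qed
    then have "card (S Y \<times> bit_strings r) = card (S (Y - {x}))"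
      by (rule bij_betw_same_card)
    then have "card (S Y) * 2 ^ r = card (S (Y - {x}))"
      by (simp add: card_cartesian_product)
    moreover have "card (S (Y - {x})) * 2 ^ (r * card (Y - {x})) = card \<Omega>"
      unfolding S_def \<Omega>_def
    proof (rule psubset.IH)
      show "Y - {x} \<subset> Y" using x(1) by blast
      show "\<exists>x\<in>Z. \<exists>i<N. \<forall>y\<in>Z. y \<noteq> x \<longrightarrow> D y ! i \<noteq> D x ! i" if "Z \<subseteq> Y - {x}" "Z \<noteq> {}" for Z
        using that by (intro psubset.prems(2)) blast
    qed (use psubset.prems(1,3) in simp_all)
    moreover have "card Y = Suc (card (Y - {x}))"
      by (rule card.remove[OF psubset.hyps(1) x(1)])
    ultimately show ?thesis
      unfolding S_def[symmetric] \<Omega>_def[symmetric] by (simp add: power_add flip: mult.assoc)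
  qed (simp add: \<Omega>_def)
qed

text \<open>Peeling shows that every admissible tuple of hash values arises from equally many
  tables, so the joint law is uniform on a product set.\<close>

lemma joint_simple_tab_peelable:
  fixes D :: "'k \<Rightarrow> nat list"
  assumes "finite X" "\<And>x. x \<in> X \<Longrightarrow> D x \<in> char_vectors s N"
    and "\<And>Z. Z \<subseteq> X \<Longrightarrow> Z \<noteq> {} \<Longrightarrow> \<exists>x\<in>Z. \<exists>i<N. \<forall>y\<in>Z. y \<noteq> x \<longrightarrow> D y ! i \<noteq> D x ! i"
  shows "map_pmf (\<lambda>T x. if x \<in> X then simple_tab xor 0 T (D x) else undefined)
      (random_tables N s (bit_strings r)) = Pi_pmf X undefined (\<lambda>_. pmf_of_set (bit_strings r))"
    (is "map_pmf ?F ?M = _")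
proof (rule pmf_eqI)
  fix \<rho> :: "'k \<Rightarrow> nat"
  let ?\<Omega> = "tables N s (bit_strings r)"
  let ?P = "PiE_dflt X undefined (\<lambda>_. bit_strings r)"
  have \<Omega>: "finite ?\<Omega>" "?\<Omega> \<noteq> {}" by (simp_all add: tables_nonempty)
  have P: "finite ?P" "?P \<noteq> {}" "card ?P = 2 ^ (r * card X)"
    using assms(1) by (auto simp: card_PiE_dflt power_mult intro!: finite_PiE_dflt)
  have "pmf (map_pmf ?F ?M) \<rho> = measure_pmf.prob ?M (?F -` {\<rho>})"
    by (rule pmf_map)
  also have "\<dots> = card (?\<Omega> \<inter> ?F -` {\<rho>}) / card ?\<Omega>"
    using \<Omega> by (simp add: random_tables_eq_pmf_of_set measure_pmf_of_set)
  also have "\<dots> = indicator ?P \<rho> / card ?P"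
  proof (cases "\<rho> \<in> ?P")
    case True
    then have "?\<Omega> \<inter> ?F -` {\<rho>} = {T \<in> ?\<Omega>. \<forall>x\<in>X. simple_tab xor 0 T (D x) = \<rho> x}"
      by (auto simp: PiE_dflt_def fun_eq_iff)
    moreover have "card {T \<in> ?\<Omega>. \<forall>x\<in>X. simple_tab xor 0 T (D x) = \<rho> x} * 2 ^ (r * card X) = card ?\<Omega>"
      by (rule card_tables_peelable[OF assms]) (use True in \<open>auto simp: PiE_dflt_def\<close>)
    from arg_cong[OF this, of real]
    have "real (card {T \<in> ?\<Omega>. \<forall>x\<in>X. simple_tab xor 0 T (D x) = \<rho> x}) * 2 ^ (r * card X) = card ?\<Omega>"
      by simp
    moreover have "card ?\<Omega> > 0" using \<Omega> by (simp add: card_gt_0_iff)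
    ultimately show ?thesis using True P(3) \<Omega>(2) by (simp add: field_simps)
  next
    case False
    \<comment> \<open>A target with a value outside the hash range, or other than
      \<open>undefined\<close> off \<open>X\<close>, is never attained.\<close>
    have "?F T \<in> ?P" if "T \<in> ?\<Omega>" for T
    proof -
      have "simple_tab xor 0 T (D x) \<in> bit_strings r" if "x \<in> X" for x
        using \<open>T \<in> ?\<Omega>\<close> char_vectors_entry[OF assms(2)[OF that]]
        by (intro simple_tab_xor_in_bit_strings) (blast intro: tablesD)
      then show ?thesis by (auto simp: PiE_dflt_def)
    qed
    then have "?\<Omega> \<inter> ?F -` {\<rho>} = {}" using False by blast
    then show ?thesis using False by simp
  qed
  also have "\<dots> = pmf (Pi_pmf X undefined (\<lambda>_. pmf_of_set (bit_strings r))) \<rho>"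
    using assms(1) P by (subst Pi_pmf_of_set) (auto simp: pmf_of_set)
  finally show "pmf (map_pmf ?F ?M) \<rho> = pmf (Pi_pmf X undefined (\<lambda>_. pmf_of_set (bit_strings r))) \<rho>" .
qed

section \<open>From keys to character vectors, and assembly of the proof\<close>

lemma key_chars_in_char_vectors:
  assumes "\<forall>i<c. w i \<le> s"
  shows "key_chars c w x \<in> char_vectors s c"
proof -
  have "take_bit (w i) y < 2 ^ s" if "i < c" for i and y :: nat
  proof -
    have "take_bit (w i) y < 2 ^ w i" by simp
    also have "\<dots> \<le> 2 ^ s" using assms that by (intro power_increasing) auto
    finally show ?thesis .
  qed
  then show ?thesis by (auto simp: key_chars_def char_vectors_def bit_strings_def)
qed

text \<open>The blocks determine the low bits of the key, one block after the other, up to its full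
  width.\<close>

lemma inj_on_key_chars: "inj_on (key_chars c w) {..<2 ^ (\<Sum>i<c. w i)}"
proof (rule inj_onI)
  fix x y assume xy: "x \<in> {..<2 ^ (\<Sum>i<c. w i)}" "y \<in> {..<2 ^ (\<Sum>i<c. w i)}"
    and "key_chars c w x = key_chars c w y"
  then have eq: "take_bit (w i) (drop_bit (\<Sum>j<i. w j) x) = take_bit (w i) (drop_bit (\<Sum>j<i. w j) y)"
    if "i < c" for i
    using that by (auto simp: key_chars_def)
  have "take_bit (\<Sum>i<k. w i) x = take_bit (\<Sum>i<k. w i) y" if "k \<le> c" for k
    using that
  proof (induction k)
    case (Suc k)
    have split: "take_bit (a + b) z = 2 ^ a * take_bit b (drop_bit a z) + take_bit a z" for a b and z :: nat
      by (simp add: take_bit_eq_mod drop_bit_eq_div power_add mod_mult2_eq)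
    show ?case using Suc eq[of k] by (simp add: split)
  qed simp
  from this[of c] show "x = y" using xy by (simp add: take_bit_nat_eq_self)
qed

text \<open>A nonempty set of keys that is not a core has a key with a derived character shared by
  no other key of the set; this is the private table entry that peeling needs.\<close>

lemma hash_independently_if_no_core:
  assumes T: "T \<in> tables c s (char_vectors s d)"
    and w: "\<forall>i<c. w i \<le> s" and X: "X \<subseteq> {..<2 ^ (\<Sum>i<c. w i)}"
    and no_core: "\<not> (\<exists>Y\<subseteq>key_chars c w ` X. core d T Y)"
  shows "hash_independently c d s r w X T"
proof -
  define D where "D x = derived_key d T (key_chars c w x)" for x
  have len: "length (key_chars c w x) = c" for x by (simp add: key_chars_def)
  have entry: "T (i, key_chars c w x ! i) \<in> char_vectors s d" if "i < c" for x i
  proof -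
    have "key_chars c w x ! i \<in> bit_strings s"
      using char_vectors_entry[OF key_chars_in_char_vectors[OF w], of i x] that len by simp
    then show ?thesis using T that by (auto intro: tablesD)
  qed
  then have lenT: "i < length (key_chars c w x) \<Longrightarrow> length (T (i, key_chars c w x ! i)) = d" for i x
    using len by (auto simp: char_vectors_def)
  have D_derived: "D x ! (c + j) = derived_char T j (key_chars c w x)" if "j < d" for x j
    using that nth_simple_tab_vec_xor[of "key_chars c w x" T d j, OF lenT]
    by (simp add: D_def derived_key_def derived_char_def nth_append len)
  have D_mem: "D x \<in> char_vectors s (c + d)" for x
  proof -
    let ?h = "simple_tab vec_xor (replicate d 0) T (key_chars c w x)"
    have h: "length ?h = d" "\<And>j. j < d \<Longrightarrow> ?h ! j = derived_char T j (key_chars c w x)"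
      using length_simple_tab_vec_xor nth_simple_tab_vec_xor lenT by (auto simp: derived_char_def)
    have "set ?h \<subseteq> bit_strings s"
      using derived_char_in_bit_strings[OF T key_chars_in_char_vectors[OF w]] h
      by (auto simp: in_set_conv_nth)
    then show ?thesis
      using h(1) key_chars_in_char_vectors[OF w, of x] by (auto simp: D_def derived_key_def char_vectors_def)
  qed
  have peel: "\<exists>x\<in>Z. \<exists>i<c + d. \<forall>y\<in>Z. y \<noteq> x \<longrightarrow> D y ! i \<noteq> D x ! i" if Z: "Z \<subseteq> X" "Z \<noteq> {}" for Z
  proof -
    have "\<not> core d T (key_chars c w ` Z)" using no_core Z(1) by blast
    then obtain x j where x: "x \<in> Z" "j < d" "\<And>y. y \<in> Z \<Longrightarrow> key_chars c w y \<noteq> key_chars c w x \<Longrightarrow>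
        derived_char T j (key_chars c w x) \<noteq> derived_char T j (key_chars c w y)"
      using Z(2) unfolding core_def by blast
    \<comment> \<open>Derived character \<open>j\<close> stands at position \<open>c + j\<close>,
      behind the input characters.\<close>
    have "D y ! (c + j) \<noteq> D x ! (c + j)" if "y \<in> Z" "y \<noteq> x" for y
    proof -
      have "key_chars c w y \<noteq> key_chars c w x"
        using inj_onD[OF inj_on_key_chars, of c w y x] that x(1) Z(1) X by blast
      then show ?thesis using x(2,3) that(1) by (metis D_derived)
    qed
    then show ?thesis using x(1,2) by (intro bexI[of _ x] exI[of _ "c + j"]) auto
  qed
  have "finite X" using X finite_subset by blast
  from indep_vars_of_joint_Pi_pmf[OF this joint_simple_tab_peelable[OF this D_mem peel]] show ?thesis
    by (auto simp: hash_independently_def mixed_tab_def D_def)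
qed

theorem theorem1:
  fixes c d :: nat and \<epsilon> :: real
  assumes "c \<ge> 1" and "\<epsilon> > 0"
  shows "\<exists>C>0. \<forall>(s::nat) (r::nat) (u::nat) (w :: nat \<Rightarrow> nat) (X :: nat set).
           root c (real u) \<le> 2 ^ s \<longrightarrow>
           (c \<ge> 2 \<longrightarrow> 2 ^ s \<le> root (c - 1) (real u)) \<longrightarrow>
           (\<forall>i<c. w i \<le> s) \<longrightarrow>
           u \<le> 2 ^ (\<Sum>i<c. w i) \<longrightarrow>
           X \<subseteq> {..<u} \<longrightarrow>
           real (card X) \<le> real (card (bit_strings s)) / (1 + \<epsilon>) \<longrightarrow>
           measure_pmf.prob (random_tables c s (char_vectors s d))
               {T1. hash_independently c d s r w X T1}
             \<ge> 1 - C * real (card (bit_strings s)) powr (1 - \<lfloor>real d / 2\<rfloor>)"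
proof -
  obtain C :: real where C: "C \<ge> 1" and bound: "\<forall>s V L. V \<subseteq> char_vectors s c \<longrightarrow>
      real (card V) \<le> 2 ^ s / (1 + \<epsilon>) \<longrightarrow> 2 ^ s \<le> (1 + \<epsilon>) ^ L \<longrightarrow> (\<forall>p<L. (1 + \<epsilon>) ^ p < 2 ^ s) \<longrightarrow>
      (\<Sum>(k, z)\<in>walk_witnesses c s V L. (1 / 2 ^ s) ^ k) \<le> C * card V / 2 ^ s"
    using walk_weight_sum_le[OF assms(2), of c] by (elim exE conjE)
  define K where "K = d div 2"
  show ?thesis
  \<comment> \<open>Each of the \<open>K\<close> pairs contributes a factor \<open>C / m\<close>,
    and the union over at most \<open>m\<close> keys a factor \<open>m\<close>.\<close>
  proof (intro exI[of _ "C ^ K"] conjI allI impI)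
    show "C ^ K > 0" using C by simp
    fix s r u :: nat and w :: "nat \<Rightarrow> nat" and X :: "nat set"
    assume w: "\<forall>i<c. w i \<le> s" and u: "u \<le> 2 ^ (\<Sum>i<c. w i)" and Xu: "X \<subseteq> {..<u}"
      and cX: "real (card X) \<le> real (card (bit_strings s)) / (1 + \<epsilon>)"
    define V where "V = key_chars c w ` X"
    define \<Omega> where "\<Omega> = tables c s (char_vectors s d)"
    define m :: real where "m = 2 ^ s"
    have m: "m > 0" by (simp add: m_def)
    have X: "X \<subseteq> {..<2 ^ (\<Sum>i<c. w i)}" "finite X"
      using Xu u finite_subset by auto
    have V: "V \<subseteq> char_vectors s c" "card V \<le> card X" "finite V"
      using key_chars_in_char_vectors[OF w] X(2) by (auto simp: V_def card_image_le)
    have cV: "real (card V) \<le> m / (1 + \<epsilon>)"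
      using V(2) cX by (simp add: m_def)
    have "\<exists>L. m \<le> (1 + \<epsilon>) ^ L"
      using real_arch_pow[of "1 + \<epsilon>" m] assms(2) less_imp_le by auto
    \<comment> \<open>The least such exponent: both conditions on the walk length then hold, the
      second by minimality.\<close>
    define L where "L = (LEAST L. m \<le> (1 + \<epsilon>) ^ L)"
    have L: "m \<le> (1 + \<epsilon>) ^ L" "\<And>p. p < L \<Longrightarrow> (1 + \<epsilon>) ^ p < m"
      using \<open>\<exists>L. m \<le> (1 + \<epsilon>) ^ L\<close> not_less_Least[of _ "\<lambda>L. m \<le> (1 + \<epsilon>) ^ L"]
      unfolding L_def by (auto intro: LeastI_ex simp: not_le)
    have weight: "(\<Sum>(k, z)\<in>walk_witnesses c s V' L. (1 / 2 ^ s) ^ k) \<le> C * card V' / 2 ^ s" if "V' \<subseteq> V" for V'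
    proof (rule bound[rule_format])
      have "card V' \<le> card V" using that V(3) by (intro card_mono)
      then show "real (card V') \<le> 2 ^ s / (1 + \<epsilon>)" using cV by (simp add: m_def)
    qed (use that V(1) L in \<open>auto simp: m_def\<close>)
    have \<Omega>: "finite \<Omega>" "\<Omega> \<noteq> {}" by (simp_all add: \<Omega>_def tables_nonempty)
    then have card\<Omega>: "real (card \<Omega>) > 0" by (simp add: card_gt_0_iff)
    let ?bad = "{T \<in> \<Omega>. \<exists>Y\<subseteq>V. core d T Y}"
    have "real (card ?bad) \<le> card V * (C / m) ^ K * card \<Omega>"
      unfolding \<Omega>_def K_def m_def by (rule card_core_le[OF weight order_refl V(1)])
    also have "\<dots> \<le> m * (C / m) ^ K * card \<Omega>"
    proof (intro mult_right_mono)
      have "m / (1 + \<epsilon>) \<le> m" using m assms(2) by (simp add: field_simps)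
      then show "real (card V) \<le> m" using cV by linarith
    qed (use C m in auto)
    finally have bad: "card ?bad / card \<Omega> \<le> m * (C / m) ^ K"
      using card\<Omega> by (simp add: pos_divide_le_eq)
    have "\<lfloor>real d / 2\<rfloor> = int K"
      unfolding K_def using floor_divide_of_nat_eq[of d 2] by simp
    then have "C ^ K * m powr (1 - \<lfloor>real d / 2\<rfloor>) = m * (C / m) ^ K"
      using m by (simp add: powr_diff powr_realpow power_divide)
    then have "1 - C ^ K * m powr (1 - \<lfloor>real d / 2\<rfloor>) \<le> 1 - card ?bad / card \<Omega>"
      using bad by linarith
    also have "\<dots> = card (\<Omega> - ?bad) / card \<Omega>"
      using \<Omega> card\<Omega> card_mono[OF \<Omega>(1), of ?bad]
      by (simp add: card_Diff_subset of_nat_diff diff_divide_distrib)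
    also have "\<dots> \<le> card (\<Omega> \<inter> {T1. hash_independently c d s r w X T1}) / card \<Omega>"
    proof (intro divide_right_mono of_nat_mono card_mono)
      show "\<Omega> - ?bad \<subseteq> \<Omega> \<inter> {T1. hash_independently c d s r w X T1}"
        using hash_independently_if_no_core[OF _ w X(1)] unfolding \<Omega>_def V_def by blast
    qed (use \<Omega> in auto)
    also have "\<dots> = measure_pmf.prob (random_tables c s (char_vectors s d))
        {T1. hash_independently c d s r w X T1}"
      using \<Omega> unfolding \<Omega>_def by (simp add: random_tables_eq_pmf_of_set measure_pmf_of_set)
    finally show "measure_pmf.prob (random_tables c s (char_vectors s d))
        {T1. hash_independently c d s r w X T1} \<ge> 1 - C ^ K * real (card (bit_strings s)) powr (1 - \<lfloor>real d / 2\<rfloor>)"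
      by (simp add: m_def)
  qed
qed

end
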